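(* Let $(\mathcal{M},g)$ be a paracompact, connected, pseudo-Riemannian manifold of dimension $n$ and signature $(p,q)$, and let $U\subseteq\mathcal{M}$ be an open set with a local orthonormal coframe $\{e^1,\dots,e^n\}$ of $T^{*}\mathcal{M}$. If $n$ is odd and $p-q\equiv 0,1,4,5\pmod 8$, then (i) the maps $P_\pm$ are endomorphisms of the algebra $(\Gamma(U,\bigwedge(T^{*}\mathcal{M})),\diamond)$ (i.e. linear, with $P_\pm(f_1\diamond f_2)=P_\pm(f_1)\diamond P_\pm(f_2)$ for all $f_1,f_2$); (ii) $\Gamma_+$ and $\Gamma_-$ are subalgebras of $(\Gamma(U,\bigwedge(T^{*}\mathcal{M})),\diamond)$ (i.e. linear subspaces closed under $\diamond$); (iii) the units of $(\Gamma_+,\diamond)$ and $(\Gamma_-,\diamond)$ are $p_+$ and $p_-$ respectively.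
   Context: The constant function $1$ on $U$, viewed as a $0$-form, is denoted $1_\Gamma$. Let $\{e_1,\dots,e_n\}$ be the frame of $T\mathcal{M}$ over $U$ dual to $\{e^i\}$, so $e^i(e_j)=\delta^i_j$. Let $g^{*}$ be the metric induced by $g$ on $T^{*}\mathcal{M}$ and $g^{ij}=g^{*}(e^i,e^j)$; orthonormal means $g^{ij}=0$ for $i\ne j$, $g^{ii}=1$ for $1\le i\le p$ and $g^{ii}=-1$ for $p+1\le i\le n$. $e_i\rfloor$ denotes contraction (interior product) on forms: the linear map of degree $-1$ vanishing on $0$-forms with $e_i\rfloor e^j=\delta_i^j 1_\Gamma$ and $e_i\rfloor(\alpha\wedge\beta)=(e_i\rfloor\alpha)\wedge\beta+(-1)^{\deg\alpha}\alpha\wedge(e_i\rfloor\beta)$. The contracted wedge product of order $l\ge 0$ on $\Gamma(U,\bigwedge(T^{*}\mathcal{M}))$ is defined iteratively by $f_1\wedge_0 f_2=f_1\wedge f_2$ and $f_1\wedge_l f_2=\sum_{i,j=1}^n g^{ij}(e_i\rfloor f_1)\wedge_{l-1}(e_j\rfloor f_2)$ for $l\ge1$. The Graf product $\diamond$ is the bilinear product on $\Gamma(U,\bigwedge(T^{*}\mathcal{M}))$ defined for an $r$-form $f_1$ and an $s$-form $f_2$ with $r\le s$ by $$f_1\diamond f_2=\sum_{l=0}^r\frac{(-1)^{l(r-l)+[l/2]}}{l!}f_1\wedge_l f_2,\qquad f_2\diamond f_1=(-1)^{rs}\sum_{l=0}^r\frac{(-1)^{l(r-l+1)+[l/2]}}{l!}f_1\wedge_l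 f_2,$$ where $[x]$ is the integer part of $x$. Let $\mathbf{v}=e^1\wedge\cdots\wedge e^n$ be the volume element. The Hodge operator is the linear map $\star f=f\diamond\mathbf{v}$ on $\Gamma(U,\bigwedge(T^{*}\mathcal{M}))$. Put $p_\pm=\frac12(1_\Gamma\pm\mathbf{v})$, $P_\pm(f)=f\diamond p_\pm=\frac12(f\pm\star f)$, and $\Gamma_\pm=P_\pm\big(\Gamma(U,\bigwedge(T^{*}\mathcal{M}))\big)$. Endomorphisms and subalgebras are not required to preserve or contain the unit $1_\Gamma$. *)

theory Defs
  imports "HOL-Analysis.Analysis" "HOL-Library.Function_Algebras"
begin

section \<open>Pointwise real vector space structure on functions\<close>

instantiation "fun" :: (type, real_vector) real_vector
begin

definition scaleR_fun_def: "a *\<^sub>R f = (\<lambda>x. a *\<^sub>R f x)"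

instance
  by standard (auto simp: scaleR_fun_def fun_eq_iff scaleR_add_right scaleR_add_left)

end

lemma scaleR_fun_apply [simp]: "(a *\<^sub>R f) x = a *\<^sub>R f x"
  by (simp add: scaleR_fun_def)


section \<open>Smooth manifolds\<close>

text \<open>Meant for open sets; there \<open>smooth_on\<close> is \<open>C\<^sup>\<infinity>\<close>, expressed through iterated
  directional derivatives.\<close>

primrec Ck_on :: "nat \<Rightarrow> 'a::euclidean_space set \<Rightarrow> ('a \<Rightarrow> 'b::real_normed_vector) \<Rightarrow> bool" where
  "Ck_on 0 S f \<longleftrightarrow> continuous_on S f"
| "Ck_on (Suc k) S f \<longleftrightarrow> (\<forall>x\<in>S. f differentiable (at x)) \<and>
     (\<forall>v. Ck_on k S (\<lambda>x. frechet_derivative f (at x) v))"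

definition smooth_on :: "'a::euclidean_space set \<Rightarrow> ('a \<Rightarrow> 'b::real_normed_vector) \<Rightarrow> bool" where
  "smooth_on S f \<longleftrightarrow> (\<forall>k. Ck_on k S f)"

definition paracompact_space :: "'m::topological_space itself \<Rightarrow> bool" where
  "paracompact_space _ \<longleftrightarrow>
     (\<forall>\<C>. (\<forall>C\<in>\<C>. open C) \<and> \<Union>\<C> = (UNIV :: 'm set) \<longrightarrow>
        (\<exists>\<D>. (\<forall>D\<in>\<D>. open D \<and> (\<exists>C\<in>\<C>. D \<subseteq> C)) \<and> \<Union>\<D> = (UNIV :: 'm set) \<and>
             locally_finite_in euclidean \<D>))"

text \<open>A chart is a pair of its domain and its coordinate map; the manifold is the whole type
  \<open>'m\<close>, modelled on \<open>'e\<close>, so its dimension is \<open>DIM('e)\<close>.\<close>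

type_synonym ('m, 'e) chart = "'m set \<times> ('m \<Rightarrow> 'e)"

definition chart_inv :: "('m, 'e) chart \<Rightarrow> 'e \<Rightarrow> 'm" where
  "chart_inv c = inv_into (fst c) (snd c)"

definition smooth_atlas :: "('m::topological_space, 'e::euclidean_space) chart set \<Rightarrow> bool" where
  "smooth_atlas A \<longleftrightarrow>
     (\<Union>c\<in>A. fst c) = UNIV \<and>
     (\<forall>c\<in>A. open (fst c) \<and> open (snd c ` fst c) \<and>
        homeomorphism (fst c) (snd c ` fst c) (snd c) (chart_inv c)) \<and>
     (\<forall>c\<in>A. \<forall>d\<in>A. smooth_on (snd c ` (fst c \<inter> fst d)) (snd d \<circ> chart_inv c))"

text \<open>The tangent space at \<open>x\<close> is realised as the model space \<open>'e\<close>, by means of a chosen chart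
  around \<open>x\<close>. With respect to any other chart \<open>c\<close> around \<open>x\<close>, the tangent vector with coordinates
  \<open>b\<close> is \<open>chart_vector A c x b\<close>, obtained from \<open>b\<close> by the Jacobian of the change of charts. Hence
  \<open>\<lambda>x. chart_vector A c x b\<close> is the vector field on the domain of \<open>c\<close> whose coordinates in \<open>c\<close>
  are constantly \<open>b\<close>; for basis vectors \<open>b\<close> these are the coordinate vector fields of \<open>c\<close>.
  The chosen charts may vary discontinuously with \<open>x\<close>, so smoothness of tensor fields is always
  tested on the fields \<open>chart_vector A c\<close>.\<close>

definition chosen_chart :: "('m, 'e) chart set \<Rightarrow> 'm \<Rightarrow> ('m, 'e) chart" where
  "chosen_chart A x = (SOME c. c \<in> A \<and> x \<in> fst c)"

definition chart_vector ::
  "('m, 'e::euclidean_space) chart set \<Rightarrow> ('m, 'e) chart \<Rightarrow> 'm \<Rightarrow> 'e \<Rightarrow> 'e" where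
  "chart_vector A c x = frechet_derivative (snd (chosen_chart A x) \<circ> chart_inv c) (at (snd c x))"

type_synonym ('m, 'e) metric = "'m \<Rightarrow> 'e \<Rightarrow> 'e \<Rightarrow> real"

definition nondegenerate :: "('e::euclidean_space \<Rightarrow> 'e \<Rightarrow> real) \<Rightarrow> bool" where
  "nondegenerate B \<longleftrightarrow> (\<forall>v. (\<forall>w. B v w = 0) \<longrightarrow> v = 0)"

definition has_signature :: "('e::euclidean_space \<Rightarrow> 'e \<Rightarrow> real) \<Rightarrow> nat \<Rightarrow> nat \<Rightarrow> bool" where
  "has_signature B p q \<longleftrightarrow> p + q = DIM('e) \<and>
     (\<exists>b :: nat \<Rightarrow> 'e. inj_on b {1..DIM('e)} \<and> independent (b ` {1..DIM('e)}) \<and>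
        span (b ` {1..DIM('e)}) = UNIV \<and>
        (\<forall>i\<in>{1..DIM('e)}. \<forall>j\<in>{1..DIM('e)}.
           B (b i) (b j) = (if i \<noteq> j then 0 else if i \<le> p then 1 else - 1)))"

definition pseudo_riemannian_manifold ::
  "('m::t2_space, 'e::euclidean_space) chart set \<Rightarrow> ('m, 'e) metric \<Rightarrow> nat \<Rightarrow> nat \<Rightarrow> bool" where
  "pseudo_riemannian_manifold A g p q \<longleftrightarrow>
     smooth_atlas A \<and> paracompact_space TYPE('m) \<and> connected (UNIV :: 'm set) \<and>
     (\<forall>x. bilinear (g x) \<and> (\<forall>v w. g x v w = g x w v) \<and> nondegenerate (g x) \<and>
          has_signature (g x) p q) \<and>
     (\<forall>c\<in>A. \<forall>b b'. smooth_on (snd c ` fst c)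
        (\<lambda>y. let x = chart_inv c y in g x (chart_vector A c x b) (chart_vector A c x b')))"


section \<open>Differential forms\<close>

text \<open>An element of the exterior algebra of the dual of \<open>'e\<close>, of mixed degree, is a function on
  lists of vectors: its component of degree \<open>k\<close> is the restriction to lists of length \<open>k\<close>, an
  alternating \<open>k\<close>-linear map. Components of degree greater than \<open>DIM('e)\<close> vanish automatically.\<close>

type_synonym 'e multicovector = "'e list \<Rightarrow> real"

definition alternating_multilinear :: "'e::euclidean_space multicovector \<Rightarrow> bool" where
  "alternating_multilinear \<alpha> \<longleftrightarrow>
     (\<forall>us vs. linear (\<lambda>v. \<alpha> (us @ v # vs))) \<and> (\<forall>vs. \<not> distinct vs \<longrightarrow> \<alpha> vs = 0)"

type_synonym ('m, 'e) form = "'m \<Rightarrow> 'e multicovector"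

text \<open>Smooth sections of the exterior bundle over \<open>U\<close>, extended by zero outside \<open>U\<close> so that
  equality of sections is equality of functions.\<close>

definition sections ::
  "('m::topological_space, 'e::euclidean_space) chart set \<Rightarrow> 'm set \<Rightarrow> ('m, 'e) form set" where
  "sections A U = {f.
     (\<forall>x\<in>U. alternating_multilinear (f x)) \<and> (\<forall>x. x \<notin> U \<longrightarrow> f x = 0) \<and>
     (\<forall>c\<in>A. \<forall>bs. smooth_on (snd c ` (fst c \<inter> U))
        (\<lambda>y. let x = chart_inv c y in f x (map (chart_vector A c x) bs)))}"

definition degree_part :: "nat \<Rightarrow> ('m, 'e) form \<Rightarrow> ('m, 'e) form" where
  "degree_part r f = (\<lambda>x vs. if length vs = r then f x vs else 0)"

definition is_form_of_degree :: "nat \<Rightarrow> ('m, 'e) form \<Rightarrow> bool" where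
  "is_form_of_degree r f \<longleftrightarrow> (\<forall>x vs. length vs \<noteq> r \<longrightarrow> f x vs = 0)"

definition one_form :: "'m set \<Rightarrow> ('m, 'e) form" where
  "one_form U = (\<lambda>x vs. if x \<in> U \<and> vs = [] then 1 else 0)"

text \<open>Sum over shuffles: a set \<open>S\<close> of positions stands for the shuffle moving the arguments at
  positions in \<open>S\<close> to the front, and its sign is given by the number of inversions.\<close>

definition inversions :: "nat set \<Rightarrow> nat" where
  "inversions S = card {(i, j). i \<in> S \<and> j \<notin> S \<and> j < i}"

definition wedge :: "('m, 'e) form \<Rightarrow> ('m, 'e) form \<Rightarrow> ('m, 'e) form" where
  "wedge f h = (\<lambda>x vs. \<Sum>S\<in>Pow {..<length vs}.
     (- 1) ^ inversions S * f x (nths vs S) * h x (nths vs (- S)))"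

definition contraction :: "('m \<Rightarrow> 'e) \<Rightarrow> ('m, 'e) form \<Rightarrow> ('m, 'e) form" where
  "contraction X f = (\<lambda>x vs. f x (X x # vs))"

text \<open>The defining properties of the contraction: linearity, degree \<open>- 1\<close>, its value on
  one-forms, and the graded Leibniz rule.\<close>

lemma contraction_linear: "linear (contraction X)"
  by (rule linearI) (simp_all add: contraction_def fun_eq_iff)

lemma contraction_degree_0: "is_form_of_degree 0 f \<Longrightarrow> contraction X f = 0"
  by (simp add: contraction_def is_form_of_degree_def fun_eq_iff)

lemma contraction_degree_Suc:
  "is_form_of_degree (Suc r) f \<Longrightarrow> is_form_of_degree r (contraction X f)"
  by (simp add: contraction_def is_form_of_degree_def)

lemma contraction_degree_1:
  assumes "is_form_of_degree 1 f" and "\<And>x. x \<notin> U \<Longrightarrow> f x = 0"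
  shows "contraction X f = (\<lambda>x. f x [X x] *\<^sub>R one_form U x)"
  using assms by (auto simp: contraction_def is_form_of_degree_def one_form_def fun_eq_iff)

lemma finite_inversions: "finite S \<Longrightarrow> finite {(i, j). i \<in> S \<and> j \<notin> S \<and> j < (i::nat)}"
  by (rule finite_subset[of _ "S \<times> {..Max S}"]) (auto intro: order.trans[OF less_imp_le Max_ge])

lemma inversions_Suc_image:
  assumes "finite S"
  shows "inversions (Suc ` S) = card S + inversions S"
proof -
  let ?I = "{(i, j). i \<in> S \<and> j \<notin> S \<and> j < (i::nat)}"
  have "{(i, j). i \<in> Suc ` S \<and> j \<notin> Suc ` S \<and> j < i} =
      (\<lambda>i. (Suc i, 0)) ` S \<union> map_prod Suc Suc ` ?I" (is "?L = ?R")
  proof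
    show "?L \<subseteq> ?R"
    proof clarify
      fix i j assume *: "i \<in> S" "j \<notin> Suc ` S" "j < Suc i" "(Suc i, j) \<notin> map_prod Suc Suc ` ?I"
      then show "(Suc i, j) \<in> (\<lambda>i. (Suc i, 0)) ` S"
        by (cases j) (force simp: image_iff)+
    qed
  qed auto
  moreover have "card \<dots> = card S + card ?I"
  proof (subst card_Un_disjoint)
    have "card ((\<lambda>i. (Suc i, 0::nat)) ` S) = card S" "card (map_prod Suc Suc ` ?I) = card ?I"
      by (rule card_image, auto simp: inj_on_def)+
    then show "card ((\<lambda>i. (Suc i, 0::nat)) ` S) + card (map_prod Suc Suc ` ?I) = card S + card ?I"
      by simp
  qed (use assms finite_inversions[OF assms] in auto)
  ultimately show ?thesis
    by (simp add: inversions_def)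
qed

lemma inversions_insert_0: "inversions (insert 0 (Suc ` S)) = inversions S"
proof -
  have "{(i, j). i \<in> insert 0 (Suc ` S) \<and> j \<notin> insert 0 (Suc ` S) \<and> j < i} =
      map_prod Suc Suc ` {(i, j). i \<in> S \<and> j \<notin> S \<and> j < i}" (is "?L = ?R")
  proof
    show "?L \<subseteq> ?R"
    proof
      fix z assume "z \<in> ?L"
      then obtain i j where z: "z = (i, j)"
        and *: "i \<in> insert 0 (Suc ` S)" "j \<notin> insert 0 (Suc ` S)" "j < i"
        by auto
      then obtain i' j' where "i = Suc i'" "j = Suc j'"
        by (metis gr_implies_not0 insertI1 not0_implies_Suc)
      with z * show "z \<in> ?R"
        by (auto simp: image_iff)
    qed
  qed auto
  then show ?thesis
    unfolding inversions_def by (simp add: card_image inj_on_def)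
qed

lemma contraction_wedge:
  fixes f h :: "('m, 'e) form"
  assumes "is_form_of_degree r f"
  shows "contraction X (wedge f h) =
    wedge (contraction X f) h + (- 1) ^ r *\<^sub>R wedge f (contraction X h)"
proof (intro ext)
  fix x and vs :: "'e list"
  let ?n = "length vs"
  let ?T = "\<lambda>S. (- 1) ^ inversions S * f x (nths (X x # vs) S) * h x (nths (X x # vs) (- S))"
  have "Pow {..<Suc ?n} = (\<lambda>S. insert 0 (Suc ` S)) ` Pow {..<?n} \<union> image Suc ` Pow {..<?n}"
    by (simp add: lessThan_Suc_eq_insert_0 Pow_insert image_Pow_surj[symmetric] Un_commute
        image_image)
  moreover have "(\<lambda>S. insert 0 (Suc ` S)) ` Pow {..<?n} \<inter> image Suc ` Pow {..<?n} = {}"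
    by auto
  ultimately have "wedge f h x (X x # vs) =
      sum ?T ((\<lambda>S. insert 0 (Suc ` S)) ` Pow {..<?n}) + sum ?T (image Suc ` Pow {..<?n})"
    by (simp add: wedge_def sum.union_disjoint)
  also have "sum ?T ((\<lambda>S. insert 0 (Suc ` S)) ` Pow {..<?n}) =
      (\<Sum>S\<in>Pow {..<?n}. ?T (insert 0 (Suc ` S)))"
  proof (rule sum.reindex[unfolded comp_def], rule inj_onI)
    fix S T assume "insert 0 (Suc ` S) = insert 0 (Suc ` T)"
    then show "S = T"
      by (auto simp: set_eq_iff)
  qed
  also have "\<dots> = wedge (contraction X f) h x vs"
  proof -
    have "{j. Suc j \<in> insert 0 (Suc ` S)} = S" "{j. Suc j \<in> - insert 0 (Suc ` S)} = - S" for S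
      by auto
    then show ?thesis
      by (simp add: wedge_def contraction_def inversions_insert_0 nths_Cons)
  qed
  also have "sum ?T (image Suc ` Pow {..<?n}) = (\<Sum>S\<in>Pow {..<?n}. ?T (Suc ` S))"
    by (rule sum.reindex[unfolded comp_def]) (auto simp: inj_on_def inj_image_eq_iff)
  also have "\<dots> = (- 1) ^ r * wedge f (contraction X h) x vs"
    unfolding wedge_def sum_distrib_left
  proof (rule sum.cong[OF refl])
    fix S assume "S \<in> Pow {..<?n}"
    then have S: "S \<subseteq> {..<?n}" "finite S"
      by (auto intro: finite_subset)
    have "{i. i < ?n \<and> i \<in> S} = S"
      using S by auto
    then have len: "length (nths vs S) = card S"
      by (simp add: length_nths)
    have sets: "{j. Suc j \<in> Suc ` S} = S" "{j. Suc j \<in> - Suc ` S} = - S"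
      by auto
    show "?T (Suc ` S) = (- 1) ^ r *
        ((- 1) ^ inversions S * f x (nths vs S) * contraction X h x (nths vs (- S)))"
    proof (cases "card S = r")
      case True
      then show ?thesis
        using S sets by (simp add: contraction_def inversions_Suc_image nths_Cons power_add)
    next
      case False
      then have "f x (nths vs S) = 0"
        using assms len by (simp add: is_form_of_degree_def)
      then show ?thesis
        using sets by (simp add: nths_Cons)
    qed
  qed
  finally show "contraction X (wedge f h) x vs =
      (wedge (contraction X f) h + (- 1) ^ r *\<^sub>R wedge f (contraction X h)) x vs"
    by (simp add: contraction_def)
qed


section \<open>Orthonormal coframes and the Graf product\<close>

text \<open>A family \<open>e\<close> of forms is used only at the indices \<open>1, \<dots>, DIM('e)\<close>.\<close>

definition covector :: "('m, 'e) form \<Rightarrow> 'm \<Rightarrow> 'e \<Rightarrow> real" where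
  "covector f x = (\<lambda>v. f x [v])"

definition local_coframe ::
  "('m::topological_space, 'e::euclidean_space) chart set \<Rightarrow> 'm set \<Rightarrow> (nat \<Rightarrow> ('m, 'e) form) \<Rightarrow> bool"
  where
  "local_coframe A U e \<longleftrightarrow>
     (\<forall>i\<in>{1..DIM('e)}. e i \<in> sections A U \<and> is_form_of_degree 1 (e i)) \<and>
     (\<forall>x\<in>U. inj_on (\<lambda>i. covector (e i) x) {1..DIM('e)} \<and>
        independent ((\<lambda>i. covector (e i) x) ` {1..DIM('e)}) \<and>
        span ((\<lambda>i. covector (e i) x) ` {1..DIM('e)}) = {\<alpha>. linear \<alpha>})"

definition dual_frame :: "(nat \<Rightarrow> ('m, 'e::euclidean_space) form) \<Rightarrow> nat \<Rightarrow> 'm \<Rightarrow> 'e" where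
  "dual_frame e i x =
     (THE v. \<forall>j\<in>{1..DIM('e)}. covector (e j) x v = (if j = i then 1 else 0))"

definition sharp :: "('e::euclidean_space \<Rightarrow> 'e \<Rightarrow> real) \<Rightarrow> ('e \<Rightarrow> real) \<Rightarrow> 'e" where
  "sharp B \<alpha> = (THE v. \<forall>w. B v w = \<alpha> w)"

definition dual_metric ::
  "('e::euclidean_space \<Rightarrow> 'e \<Rightarrow> real) \<Rightarrow> ('e \<Rightarrow> real) \<Rightarrow> ('e \<Rightarrow> real) \<Rightarrow> real" where
  "dual_metric B \<alpha> \<beta> = B (sharp B \<alpha>) (sharp B \<beta>)"

definition inverse_metric ::
  "('m, 'e::euclidean_space) metric \<Rightarrow> (nat \<Rightarrow> ('m, 'e) form) \<Rightarrow> nat \<Rightarrow> nat \<Rightarrow> 'm \<Rightarrow> real" where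
  "inverse_metric g e i j x = dual_metric (g x) (covector (e i) x) (covector (e j) x)"

definition orthonormal_coframe ::
  "('m::topological_space, 'e::euclidean_space) chart set \<Rightarrow> ('m, 'e) metric \<Rightarrow> nat \<Rightarrow> 'm set \<Rightarrow>
     (nat \<Rightarrow> ('m, 'e) form) \<Rightarrow> bool" where
  "orthonormal_coframe A g p U e \<longleftrightarrow> local_coframe A U e \<and>
     (\<forall>x\<in>U. \<forall>i\<in>{1..DIM('e)}. \<forall>j\<in>{1..DIM('e)}.
        inverse_metric g e i j x = (if i \<noteq> j then 0 else if i \<le> p then 1 else - 1))"

primrec contracted_wedge ::
  "('m, 'e::euclidean_space) metric \<Rightarrow> (nat \<Rightarrow> ('m, 'e) form) \<Rightarrow> nat \<Rightarrow>
     ('m, 'e) form \<Rightarrow> ('m, 'e) form \<Rightarrow> ('m, 'e) form" where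
  "contracted_wedge g e 0 f h = wedge f h"
| "contracted_wedge g e (Suc l) f h = (\<Sum>i=1..DIM('e). \<Sum>j=1..DIM('e). (\<lambda>x.
     inverse_metric g e i j x *\<^sub>R contracted_wedge g e l
       (contraction (dual_frame e i) f) (contraction (dual_frame e j) h) x))"

text \<open>The product of an \<open>r\<close>-form \<open>f\<close> and an \<open>s\<close>-form \<open>h\<close>.\<close>

definition graf_homogeneous ::
  "('m, 'e::euclidean_space) metric \<Rightarrow> (nat \<Rightarrow> ('m, 'e) form) \<Rightarrow> nat \<Rightarrow> nat \<Rightarrow>
     ('m, 'e) form \<Rightarrow> ('m, 'e) form \<Rightarrow> ('m, 'e) form" where
  "graf_homogeneous g e r s f h =
     (if r \<le> s
      then \<Sum>l=0..r. ((- 1) ^ (l * (r - l) + l div 2) / fact l) *\<^sub>R contracted_wedge g e l f h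
      else (- 1) ^ (r * s) *\<^sub>R
        (\<Sum>l=0..s. ((- 1) ^ (l * (s - l + 1) + l div 2) / fact l) *\<^sub>R contracted_wedge g e l h f))"

definition graf ::
  "('m, 'e::euclidean_space) metric \<Rightarrow> (nat \<Rightarrow> ('m, 'e) form) \<Rightarrow>
     ('m, 'e) form \<Rightarrow> ('m, 'e) form \<Rightarrow> ('m, 'e) form" where
  "graf g e f h = (\<Sum>r=0..DIM('e). \<Sum>s=0..DIM('e).
     graf_homogeneous g e r s (degree_part r f) (degree_part s h))"

definition volume_form ::
  "'m set \<Rightarrow> (nat \<Rightarrow> ('m, 'e::euclidean_space) form) \<Rightarrow> ('m, 'e) form" where
  "volume_form U e = foldr wedge (map e [1..<Suc DIM('e)]) (one_form U)"

text \<open>Below, the sign \<open>\<sigma>\<close> is \<open>1\<close> for the index \<open>+\<close> and \<open>- 1\<close> for the index \<open>-\<close>.\<close>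

definition p_elem :: "real \<Rightarrow> 'm set \<Rightarrow> (nat \<Rightarrow> ('m, 'e::euclidean_space) form) \<Rightarrow> ('m, 'e) form"
  where
  "p_elem \<sigma> U e = (1 / 2) *\<^sub>R (one_form U + \<sigma> *\<^sub>R volume_form U e)"

definition P_map ::
  "real \<Rightarrow> ('m, 'e::euclidean_space) metric \<Rightarrow> 'm set \<Rightarrow> (nat \<Rightarrow> ('m, 'e) form) \<Rightarrow>
     ('m, 'e) form \<Rightarrow> ('m, 'e) form" where
  "P_map \<sigma> g U e f = graf g e f (p_elem \<sigma> U e)"

definition Gamma_part ::
  "real \<Rightarrow> ('m::topological_space, 'e::euclidean_space) chart set \<Rightarrow> ('m, 'e) metric \<Rightarrow> 'm set \<Rightarrow>
     (nat \<Rightarrow> ('m, 'e) form) \<Rightarrow> ('m, 'e) form set" where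
  "Gamma_part \<sigma> A g U e = P_map \<sigma> g U e ` sections A U"


section \<open>Algebras on subspaces, with product \<open>m\<close>\<close>

definition algebra_endomorphism ::
  "'a::real_vector set \<Rightarrow> ('a \<Rightarrow> 'a \<Rightarrow> 'a) \<Rightarrow> ('a \<Rightarrow> 'a) \<Rightarrow> bool" where
  "algebra_endomorphism V m P \<longleftrightarrow>
     (\<forall>f\<in>V. P f \<in> V) \<and>
     (\<forall>f\<in>V. \<forall>h\<in>V. P (f + h) = P f + P h) \<and>
     (\<forall>a. \<forall>f\<in>V. P (a *\<^sub>R f) = a *\<^sub>R P f) \<and>
     (\<forall>f\<in>V. \<forall>h\<in>V. P (m f h) = m (P f) (P h))"

definition subalgebra_of :: "'a::real_vector set \<Rightarrow> 'a set \<Rightarrow> ('a \<Rightarrow> 'a \<Rightarrow> 'a) \<Rightarrow> bool" where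
  "subalgebra_of S V m \<longleftrightarrow> S \<subseteq> V \<and> subspace S \<and> (\<forall>f\<in>S. \<forall>h\<in>S. m f h \<in> S)"

definition is_unit_of :: "'a \<Rightarrow> 'a set \<Rightarrow> ('a \<Rightarrow> 'a \<Rightarrow> 'a) \<Rightarrow> bool" where
  "is_unit_of u S m \<longleftrightarrow> u \<in> S \<and> (\<forall>f\<in>S. m u f = f \<and> m f u = f)"

end

theory Submission
  imports Defs
begin

text \<open>
  At a point of \<open>U\<close> a form is determined by its coefficients
  \<open>f\<^sub>I = f(e\<^sub>i, \<dots>, e\<^sub>j)\<close> in the frame dual to the coframe, one for each set
  \<open>I = {i < \<dots> < j}\<close> of indices. In these coefficients the Graf product is the product of the
  Clifford algebra with generators \<open>e\<^sup>i\<close> that anticommute and have squares \<open>\<plusminus>1\<close>: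
  \<open>(f \<diamond> h)\<^sub>K\<close> is the sum over \<open>I\<close> of \<open>\<epsilon>(I, J) f\<^sub>I h\<^sub>J\<close>, where \<open>J\<close> is the symmetric
  difference of \<open>I\<close> and \<open>K\<close>, and \<open>\<epsilon>(I, J)\<close> is the sign of the product of two monomials
  (\<open>coefficient_graf\<close>). Only the terms of contraction order \<open>l\<close> equal to the size of
  \<open>I \<inter> J\<close> contribute. Each of the \<open>l!\<close> orders in which these indices can be contracted gives the
  same value, which cancels the factorial in the Graf product; the remaining signs
  in its definition are those that turn the wedge sign into \<open>\<epsilon>\<close>.

  The sign \<open>\<epsilon>\<close> is multiplicative in each argument for the symmetric difference of sets, and this
  makes \<open>\<diamond>\<close> associative. The volume form \<open>v\<close> has the single coefficient \<open>1\<close> at the full index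
  set \<open>N\<close>. For \<open>n\<close> odd, \<open>\<epsilon>(I, N) = \<epsilon>(N, I)\<close>, so \<open>v\<close> is central. Its square is
  \<open>\<epsilon>(N, N) = (-1)^(n(n-1)/2 + q)\<close>; since \<open>p - q\<close> is odd, the congruence on \<open>p - q\<close> leaves only
  \<open>p - q \<equiv> 1\<close> modulo 4, where this sign is \<open>1\<close>. Hence \<open>p\<^sub>+\<close> and \<open>p\<^sub>-\<close> are central
  idempotents, the maps \<open>P\<^sub>+\<close> and \<open>P\<^sub>-\<close> multiply by them, and the three claims follow in any
  associative algebra with unit (\<open>central_involution_splitting\<close>).

  All of this takes place among smooth sections, so \<open>\<diamond>\<close> must preserve smoothness. The one point
  that is not formal is that contracting with a vector of the dual frame does so
  (\<open>contraction_dual_frame_sections\<close>). The dual frame is smooth by Cramer's rule, which here is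
  the vanishing of the \<open>(n+1)\<close>-form \<open>\<theta> \<and> v\<close> for a covector \<open>\<theta>\<close>: its contraction with \<open>X\<close>
  expresses the coordinate \<open>\<theta>(X)\<close> as a quotient of smooth functions.
\<close>


section \<open>Signs of the Clifford algebra\<close>

text \<open>The square of the generator with index \<open>i\<close>, which is \<open>g\<^sup>i\<^sup>i\<close> for an orthonormal coframe.\<close>

definition metric_sign :: "nat \<Rightarrow> nat \<Rightarrow> real" where
  "metric_sign p i = (if i \<le> p then 1 else - 1)"

text \<open>The sign by which the product of the monomials \<open>e\<^sup>I\<close> and \<open>e\<^sup>J\<close> differs from the monomial of the
symmetric difference of \<open>I\<close> and \<open>J\<close>: sorting the factors gives \<open>-1\<close> for each pair in the wrong
order, and each common index is replaced by its square.\<close>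

definition clifford_sign :: "nat \<Rightarrow> nat set \<Rightarrow> nat set \<Rightarrow> real" where
  "clifford_sign p I J =
     (\<Prod>i\<in>I. \<Prod>j\<in>J. if j < i then - 1 else if i = j then metric_sign p i else 1)"

text \<open>The factors over \<open>A \<inter> B\<close> occur twice on the right and cancel.\<close>

lemma prod_sym_diff:
  fixes f :: "'b \<Rightarrow> real"
  assumes "finite A" "finite B" "\<And>x. f x * f x = 1"
  shows "prod f (sym_diff A B) = prod f A * prod f B"
proof -
  have A: "prod f A = prod f (A - B) * prod f (A \<inter> B)"
    using assms by (subst prod.union_disjoint[symmetric]) (auto intro: arg_cong[of _ _ "prod f"])
  have B: "prod f B = prod f (B - A) * prod f (A \<inter> B)"
    using assms by (subst prod.union_disjoint[symmetric]) (auto intro: arg_cong[of _ _ "prod f"])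
  have "prod f (A \<inter> B) * prod f (A \<inter> B) = 1"
    by (simp add: prod.distrib[symmetric] assms)
  then have "prod f A * prod f B = prod f (A - B) * prod f (B - A)"
    unfolding A B by (metis mult.assoc mult.commute mult.right_neutral)
  then show ?thesis
    using assms by (subst prod.union_disjoint) auto
qed

lemma metric_sign_square [simp]: "metric_sign p i * metric_sign p i = 1"
  by (simp add: metric_sign_def)

lemma clifford_sign_square [simp]: "clifford_sign p I J * clifford_sign p I J = 1"
  by (simp add: clifford_sign_def prod.distrib[symmetric] cong: prod.cong)
     (auto intro!: prod.neutral)

lemma clifford_sign_empty [simp]: "clifford_sign p {} J = 1" "clifford_sign p I {} = 1"
  by (simp_all add: clifford_sign_def)

lemma clifford_sign_sym_diff_left:
  assumes "finite I" "finite I'"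
  shows "clifford_sign p (sym_diff I I') J = clifford_sign p I J * clifford_sign p I' J"
  unfolding clifford_sign_def using assms
  by (rule prod_sym_diff) (auto simp: prod.distrib[symmetric] intro!: prod.neutral)

lemma clifford_sign_sym_diff_right:
  assumes "finite J" "finite J'"
  shows "clifford_sign p I (sym_diff J J') = clifford_sign p I J * clifford_sign p I J'"
  unfolding clifford_sign_def prod.distrib[symmetric] using assms
  by (intro prod.cong refl prod_sym_diff) auto

lemma clifford_sign_insert_left:
  assumes "finite I" "i \<notin> I"
  shows "clifford_sign p (insert i I) J = clifford_sign p {i} J * clifford_sign p I J"
  using assms by (simp add: clifford_sign_def)

lemma clifford_sign_insert_right:
  assumes "finite J" "j \<notin> J"
  shows "clifford_sign p I (insert j J) = clifford_sign p I {j} * clifford_sign p I J"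
  using assms by (simp add: clifford_sign_def prod.distrib)

lemma clifford_sign_singleton_left:
  assumes "finite J" "i \<notin> J"
  shows "clifford_sign p {i} J = (- 1) ^ card {j \<in> J. j < i}"
proof -
  have "clifford_sign p {i} J = (\<Prod>j\<in>J. if j < i then - 1 else 1)"
    using assms unfolding clifford_sign_def by simp (rule prod.cong, auto)
  also have "\<dots> = (- 1) ^ card {j \<in> J. j < i}"
    using assms by (simp add: prod.If_cases Int_def)
  finally show ?thesis .
qed

lemma clifford_sign_singleton_right:
  assumes "finite I" "j \<notin> I"
  shows "clifford_sign p I {j} = (- 1) ^ card {i \<in> I. j < i}"
proof -
  have "clifford_sign p I {j} = (\<Prod>i\<in>I. if j < i then - 1 else 1)"
    using assms unfolding clifford_sign_def by simp (rule prod.cong, auto)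
  also have "\<dots> = (- 1) ^ card {i \<in> I. j < i}"
    using assms by (simp add: prod.If_cases Int_def)
  finally show ?thesis .
qed

text \<open>Exchanging the arguments changes the sign once for every pair of different indices, and there are
\<open>|I| |J| - |I \<inter> J|\<close> of these.\<close>

lemma clifford_sign_commute:
  assumes "finite I" "finite J"
  shows "clifford_sign p I J * clifford_sign p J I = (- 1) ^ (card I * card J + card (I \<inter> J))"
proof -
  have inner: "(\<Prod>j\<in>J. if i = j then 1 else - 1 :: real) = (- 1) ^ (card J + (if i \<in> J then 1 else 0))"
    for i
  proof -
    have "(\<Prod>j\<in>J. if i = j then 1 else - 1 :: real) = (- 1) ^ card (J - {i})"
      using assms by (simp add: prod.If_cases Diff_eq)
    also have "\<dots> = (- 1) ^ (card J + (if i \<in> J then 1 else 0))"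
    proof (cases "i \<in> J")
      case True
      then obtain k where "card J = Suc k"
        using assms by (metis card_gt_0_iff empty_iff gr0_conv_Suc)
      then show ?thesis
        using True by simp
    qed simp
    finally show ?thesis .
  qed
  have "clifford_sign p J I = (\<Prod>i\<in>I. \<Prod>j\<in>J.
      if i < j then - 1 else if i = j then metric_sign p i else 1)"
    unfolding clifford_sign_def by (subst prod.swap) (auto intro!: prod.cong)
  then have "clifford_sign p I J * clifford_sign p J I =
      (\<Prod>i\<in>I. \<Prod>j\<in>J. if i = j then 1 else - 1)"
    unfolding clifford_sign_def prod.distrib[symmetric]
    by (auto intro!: prod.cong simp flip: prod.distrib)
  also have "\<dots> = (- 1) ^ (\<Sum>i\<in>I. card J + (if i \<in> J then 1 else 0))"
    by (simp add: inner power_sum)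
  also have "(\<Sum>i\<in>I. card J + (if i \<in> J then 1 else 0)) = card I * card J + card (I \<inter> J)"
    using assms by (simp add: sum.distrib sum.If_cases Int_def)
  finally show ?thesis .
qed

lemma clifford_sign_volume_commute:
  assumes "finite N" "I \<subseteq> N" "odd (card N)"
  shows "clifford_sign p I N = clifford_sign p N I"
proof -
  have "finite I" using assms finite_subset by blast
  moreover have "I \<inter> N = I" using assms by auto
  ultimately have "clifford_sign p I N * clifford_sign p N I = 1"
    using assms by (simp add: clifford_sign_commute)
  then show ?thesis
    using clifford_sign_square[of p I N]
    by (metis clifford_sign_square mult.assoc mult.right_neutral mult.left_neutral)
qed

lemma clifford_sign_volume_Suc:
  "clifford_sign p {1..Suc n} {1..Suc n} = clifford_sign p {1..n} {1..n} * (- 1) ^ n * metric_sign p (Suc n)"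
proof -
  have *: "{1..Suc n} = insert (Suc n) {1..n}" by auto
  have 1: "clifford_sign p {Suc n} {Suc n} = metric_sign p (Suc n)"
    by (simp add: clifford_sign_def)
  have s1: "{i \<in> {1..n}. Suc n < i} = {}" and s2: "{i \<in> {1..n}. i < Suc n} = {1..n}" by auto
  have 2: "clifford_sign p {1..n} {Suc n} = 1"
    by (subst clifford_sign_singleton_right) (auto simp only: s1, auto)
  have 3: "clifford_sign p {Suc n} {1..n} = (- 1) ^ n"
    by (subst clifford_sign_singleton_left) (auto simp only: s2, auto)
  have 4: "finite {1..n}" "Suc n \<notin> {1..n}" by auto
  show ?thesis
    unfolding * clifford_sign_insert_left[OF 4] clifford_sign_insert_right[OF 4] 1 2 3
    by (simp only: mult_ac mult_1_left)
qed

lemma triangular_Suc: "Suc n * (Suc n - 1) div 2 = n * (n - 1) div 2 + n"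
proof -
  have "Suc n * (Suc n - 1) = n * (n - 1) + n * 2"
    by (cases n) (auto simp: algebra_simps)
  then show ?thesis
    by (simp only: div_mult_self1 zero_neq_numeral[symmetric] not_False_eq_True)
qed

text \<open>Up to index \<open>p\<close> all generators have square \<open>1\<close>, so only the \<open>n(n-1)/2\<close> inversions count.\<close>

lemma clifford_sign_volume_riemannian:
  assumes "n \<le> p"
  shows "clifford_sign p {1..n} {1..n} = (- 1) ^ (n * (n - 1) div 2)"
  using assms
proof (induction n)
  case (Suc n)
  have "(- 1 :: real) ^ (Suc n * (Suc n - 1) div 2) = (- 1) ^ (n * (n - 1) div 2) * (- 1) ^ n"
    by (simp only: triangular_Suc power_add)
  with Suc show ?case
    by (simp only: clifford_sign_volume_Suc metric_sign_def if_True mult_1_right Suc_leD)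
qed simp

lemma clifford_sign_volume:
  "clifford_sign p {1..p + q} {1..p + q} = (- 1) ^ ((p + q) * (p + q - 1) div 2 + q)"
proof (induction q)
  case 0
  then show ?case using clifford_sign_volume_riemannian[of p p] by simp
next
  case (Suc q)
  let ?n = "p + q"
  have "(- 1 :: real) ^ (Suc ?n * (Suc ?n - 1) div 2 + Suc q) =
      (- 1) ^ (?n * (?n - 1) div 2 + q) * (- 1) ^ ?n * (- 1)"
    by (simp only: triangular_Suc power_add power_Suc2 mult_ac)
  moreover have "metric_sign p (Suc ?n) = - 1"
    by (simp add: metric_sign_def)
  ultimately show ?case
    using Suc by (simp only: clifford_sign_volume_Suc add_Suc_right)
qed

text \<open>With \<open>p = q + 1 + 4k\<close> and \<open>m = q + 2k\<close> the dimension is \<open>2m + 1\<close>, and the exponent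
\<open>(2m + 1) m + q\<close> is congruent to \<open>m + q = 2q + 2k\<close> modulo 2.\<close>

lemma clifford_sign_volume_eq_1:
  assumes "odd (p + q)" "(int p - int q) mod 8 \<in> {0, 1, 4, 5}"
  shows "clifford_sign p {1..p + q} {1..p + q} = 1"
proof -
  have "(int p - int q) mod 8 = 1 \<or> (int p - int q) mod 8 = 5"
    using assms by auto presburger+
  then have "(int p - int q) mod 4 = 1"
    by presburger
  then have "int p - int q = 4 * ((int p - int q) div 4) + 1"
    using mult_div_mod_eq[of 4 "int p - int q"] by simp
  then obtain k where k: "int p = int q + 1 + 4 * k"
    by (metis add.commute add.left_commute diff_eq_eq)
  have "even ((p + q) * (p + q - 1) div 2 + q)"
  proof -
    have p: "p + q \<ge> 1" using assms(1) by (cases "p + q") auto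
    define m where "m = int q + 2 * k"
    have m: "int (p + q) = 2 * m + 1" using k by (simp add: m_def)
    have m2: "int (p + q - 1) = 2 * m" using m p by linarith
    have "int ((p + q) * (p + q - 1)) = 2 * ((2 * m + 1) * m)"
      by (simp only: of_nat_mult m m2 mult_ac)
    then have "int ((p + q) * (p + q - 1) div 2) = (2 * m + 1) * m"
      by (simp add: zdiv_int)
    then have "int ((p + q) * (p + q - 1) div 2 + q) = (2 * m + 1) * m + int q"
      by simp
    then have "even (int ((p + q) * (p + q - 1) div 2 + q))"
      by (simp add: m_def)
    then show ?thesis by (simp only: even_of_nat)
  qed
  then show ?thesis
    by (simp only: clifford_sign_volume neg_one_even_power)
qed

section \<open>The Clifford product in coefficients\<close>

text \<open>The product of the Clifford algebra on the coefficients with respect to the monomials \<open>e\<^sup>I\<close>,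
\<open>I \<subseteq> N\<close>.\<close>

definition clifford_mult ::
  "nat \<Rightarrow> nat set \<Rightarrow> (nat set \<Rightarrow> real) \<Rightarrow> (nat set \<Rightarrow> real) \<Rightarrow> nat set \<Rightarrow> real" where
  "clifford_mult p N a b K =
     (\<Sum>I\<in>Pow N. clifford_sign p I (sym_diff I K) * a I * b (sym_diff I K))"

text \<open>Both sides sum over triples of sets whose symmetric difference is \<open>K\<close>. Their signs agree because
bimultiplicativity turns \<open>\<epsilon>(I, J) \<epsilon>(I \<triangle> J, L)\<close> and \<open>\<epsilon>(I, J \<triangle> L) \<epsilon>(J, L)\<close> into the same product
\<open>\<epsilon>(I, J) \<epsilon>(I, L) \<epsilon>(J, L)\<close>.\<close>

lemma clifford_mult_assoc:
  assumes "finite N" "K \<subseteq> N"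
  shows "clifford_mult p N (clifford_mult p N a b) c K = clifford_mult p N a (clifford_mult p N b c) K"
proof -
  let ?s = "clifford_sign p" and ?D = "\<lambda>A B. sym_diff A B :: nat set"
  have "clifford_mult p N (clifford_mult p N a b) c K =
      (\<Sum>L\<in>Pow N. \<Sum>I\<in>Pow N. ?s L (?D L K) * (?s I (?D I L) * a I * b (?D I L)) * c (?D L K))"
    unfolding clifford_mult_def sum_distrib_left sum_distrib_right ..
  also have "\<dots> = (\<Sum>I\<in>Pow N. \<Sum>L\<in>Pow N. ?s L (?D L K) * (?s I (?D I L) * a I * b (?D I L)) * c (?D L K))"
    by (rule sum.swap)
  also have "\<dots> = (\<Sum>I\<in>Pow N. \<Sum>J\<in>Pow N.
      ?s I (?D I K) * a I * (?s J (?D J (?D I K)) * b J * c (?D J (?D I K))))"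
  proof (rule sum.cong[OF refl])
    fix I assume I: "I \<in> Pow N"
    show "(\<Sum>L\<in>Pow N. ?s L (?D L K) * (?s I (?D I L) * a I * b (?D I L)) * c (?D L K)) =
      (\<Sum>J\<in>Pow N. ?s I (?D I K) * a I * (?s J (?D J (?D I K)) * b J * c (?D J (?D I K))))"
    \<comment> \<open>On the left \<open>L\<close> indexes the product of the first two factors, on the right \<open>J\<close> indexes the
      second factor.\<close>
    proof (rule sum.reindex_bij_witness[of _ "\<lambda>J. ?D I J" "\<lambda>L. ?D I L"])
      fix L assume L: "L \<in> Pow N"
      have fin: "finite L" "finite I" "finite K"
        using assms I L finite_subset[of _ N] by auto
      have D1: "?D (?D I L) (?D I K) = ?D L K" by auto
      have D2: "?D I L = ?D (?D I K) (?D L K)" by auto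
      have "?s (?D I L) (?D L K) = ?s I (?D L K) * ?s L (?D L K)"
        using fin by (simp add: clifford_sign_sym_diff_left)
      moreover have "?s I (?D I L) = ?s I (?D I K) * ?s I (?D L K)"
        by (subst D2, rule clifford_sign_sym_diff_right) (use fin in auto)
      ultimately have *: "?s I (?D I K) * ?s (?D I L) (?D L K) = ?s L (?D L K) * ?s I (?D I L)"
        by simp
      show "?s I (?D I K) * a I * (?s (?D I L) (?D (?D I L) (?D I K)) * b (?D I L) *
          c (?D (?D I L) (?D I K))) =
        ?s L (?D L K) * (?s I (?D I L) * a I * b (?D I L)) * c (?D L K)"
      proof -
        have "?s I (?D I K) * a I * (?s (?D I L) (?D L K) * b (?D I L) * c (?D L K)) =
            (?s I (?D I K) * ?s (?D I L) (?D L K)) * (a I * b (?D I L) * c (?D L K))"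
          by (simp only: ac_simps)
        then show ?thesis
          unfolding D1 * by (simp only: ac_simps)
      qed
    qed (use I in auto)
  qed
  also have "\<dots> = clifford_mult p N a (clifford_mult p N b c) K"
    unfolding clifford_mult_def sum_distrib_left sum_distrib_right ..
  finally show ?thesis .
qed

lemma clifford_mult_one_left:
  assumes "finite N" "K \<subseteq> N"
  shows "clifford_mult p N (\<lambda>I. if I = {} then 1 else 0) b K = b K"
proof -
  have "clifford_mult p N (\<lambda>I. if I = {} then 1 else 0) b K =
      (\<Sum>I\<in>Pow N. if I = {} then b K else 0)"
    unfolding clifford_mult_def by (rule sum.cong) auto
  then show ?thesis using assms by simp
qed

lemma clifford_mult_one_right:
  assumes "finite N" "K \<subseteq> N"
  shows "clifford_mult p N a (\<lambda>I. if I = {} then 1 else 0) K = a K"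
proof -
  have "clifford_mult p N a (\<lambda>I. if I = {} then 1 else 0) K =
      (\<Sum>I\<in>Pow N. if I = K then a K else 0)"
    unfolding clifford_mult_def
  proof (rule sum.cong[OF refl])
    fix I
    have "sym_diff I K = {} \<longleftrightarrow> I = K" by auto
    then show "clifford_sign p I (sym_diff I K) * a I * (if sym_diff I K = {} then 1 else 0) =
        (if I = K then a K else 0)"
      by (cases "I = K") auto
  qed
  then show ?thesis using assms by simp
qed

lemma clifford_mult_volume_left:
  assumes "finite N" "K \<subseteq> N"
  shows "clifford_mult p N (\<lambda>I. if I = N then 1 else 0) b K =
    clifford_sign p N (N - K) * b (N - K)"
proof -
  have "N - K \<union> (K - N) = N - K" using assms by auto
  then have "clifford_mult p N (\<lambda>I. if I = N then 1 else 0) b K =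
      (\<Sum>I\<in>Pow N. if I = N then clifford_sign p N (N - K) * b (N - K) else 0)"
    unfolding clifford_mult_def by (intro sum.cong) auto
  then show ?thesis using assms by simp
qed

lemma clifford_mult_volume_right:
  assumes "finite N" "K \<subseteq> N"
  shows "clifford_mult p N a (\<lambda>I. if I = N then 1 else 0) K =
    clifford_sign p (N - K) N * a (N - K)"
proof -
  have "clifford_mult p N a (\<lambda>I. if I = N then 1 else 0) K =
      (\<Sum>I\<in>Pow N. if I = N - K then clifford_sign p (N - K) N * a (N - K) else 0)"
    unfolding clifford_mult_def
  proof (rule sum.cong[OF refl])
    fix I assume "I \<in> Pow N"
    then have "sym_diff I K = N \<longleftrightarrow> I = N - K" using assms by auto
    then show "clifford_sign p I (sym_diff I K) * a I * (if sym_diff I K = N then 1 else 0) =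
        (if I = N - K then clifford_sign p (N - K) N * a (N - K) else 0)"
      by (cases "I = N - K") auto
  qed
  then show ?thesis using assms by simp
qed

lemma clifford_volume_central:
  assumes "finite N" "K \<subseteq> N" "odd (card N)"
  shows "clifford_mult p N (\<lambda>I. if I = N then 1 else 0) b K =
    clifford_mult p N b (\<lambda>I. if I = N then 1 else 0) K"
  using assms by (simp add: clifford_mult_volume_left clifford_mult_volume_right
      clifford_sign_volume_commute[of N "N - K"])

lemma clifford_volume_square:
  assumes "finite N" "K \<subseteq> N" "clifford_sign p N N = 1"
  shows "clifford_mult p N (\<lambda>I. if I = N then 1 else 0) (\<lambda>I. if I = N then 1 else 0) K =
    (if K = {} then 1 else 0)"
proof -
  have "N - K = N \<longleftrightarrow> K = {}" using assms by auto
  then show ?thesis using assms by (simp add: clifford_mult_volume_left)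
qed

lemma clifford_mult_cong:
  assumes "\<And>I. I \<subseteq> N \<Longrightarrow> a I = a' I" "\<And>I. I \<subseteq> N \<Longrightarrow> b I = b' I" "K \<subseteq> N"
  shows "clifford_mult p N a b K = clifford_mult p N a' b' K"
  unfolding clifford_mult_def
proof (rule sum.cong[OF refl])
  fix I assume "I \<in> Pow N"
  then have "I \<subseteq> N" "sym_diff I K \<subseteq> N" using assms(3) by auto
  then show "clifford_sign p I (sym_diff I K) * a I * b (sym_diff I K) =
      clifford_sign p I (sym_diff I K) * a' I * b' (sym_diff I K)"
    by (simp only: assms)
qed

section \<open>Algebras with a central square root of the unit\<close>

text \<open>The element \<open>p\<close> is a central idempotent, since \<open>(u + \<sigma> v)(u + \<sigma> v) = 2 (u + \<sigma> v)\<close>. Multiplication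
by \<open>p\<close> is therefore multiplicative, its image is the ideal generated by \<open>p\<close>, and \<open>p\<close> is the unit
there.\<close>

lemma central_involution_splitting:
  fixes V :: "'a::real_vector set" and m :: "'a \<Rightarrow> 'a \<Rightarrow> 'a"
  assumes V: "subspace V" and closed: "\<And>f h. f \<in> V \<Longrightarrow> h \<in> V \<Longrightarrow> m f h \<in> V"
    and add_left: "\<And>f f' h. f \<in> V \<Longrightarrow> f' \<in> V \<Longrightarrow> h \<in> V \<Longrightarrow> m (f + f') h = m f h + m f' h"
    and add_right: "\<And>f h h'. f \<in> V \<Longrightarrow> h \<in> V \<Longrightarrow> h' \<in> V \<Longrightarrow> m f (h + h') = m f h + m f h'"
    and scale_left: "\<And>a f h. f \<in> V \<Longrightarrow> h \<in> V \<Longrightarrow> m (a *\<^sub>R f) h = a *\<^sub>R m f h"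
    and scale_right: "\<And>a f h. f \<in> V \<Longrightarrow> h \<in> V \<Longrightarrow> m f (a *\<^sub>R h) = a *\<^sub>R m f h"
    and assoc: "\<And>f h k. f \<in> V \<Longrightarrow> h \<in> V \<Longrightarrow> k \<in> V \<Longrightarrow> m (m f h) k = m f (m h k)"
    and u: "u \<in> V" "\<And>f. f \<in> V \<Longrightarrow> m u f = f" "\<And>f. f \<in> V \<Longrightarrow> m f u = f"
    and v: "v \<in> V" "\<And>f. f \<in> V \<Longrightarrow> m v f = m f v" "m v v = u"
    and \<sigma>: "\<sigma> * \<sigma> = (1::real)"
    and p: "p = (1 / 2) *\<^sub>R (u + \<sigma> *\<^sub>R v)"
  shows "algebra_endomorphism V m (\<lambda>f. m f p) \<and> subalgebra_of ((\<lambda>f. m f p) ` V) V m \<and>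
    is_unit_of p ((\<lambda>f. m f p) ` V) m"
proof -
  have pV: "p \<in> V"
    unfolding p using V u(1) v(1) by (intro subspace_scale subspace_add) auto
  have pp: "m p p = p"
  proof -
    have sv: "\<sigma> *\<^sub>R v \<in> V" and us: "u + \<sigma> *\<^sub>R v \<in> V"
      using V u(1) v(1) by (auto intro: subspace_scale subspace_add)
    have sq: "\<sigma> *\<^sub>R \<sigma> *\<^sub>R x = x" for x :: 'a
      using \<sigma> by simp
    have "m (u + \<sigma> *\<^sub>R v) (u + \<sigma> *\<^sub>R v) = (u + \<sigma> *\<^sub>R v) + (\<sigma> *\<^sub>R v + u)"
      using u v(1) v(3) sv us
      by (simp add: add_left add_right scale_left scale_right scaleR_add_right sq del: scaleR_scaleR)
    then have "m (u + \<sigma> *\<^sub>R v) (u + \<sigma> *\<^sub>R v) = 2 *\<^sub>R (u + \<sigma> *\<^sub>R v)"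
      by (simp only: scaleR_2 add_ac)
    then show ?thesis
      using us V by (simp add: p scale_left scale_right subspace_scale)
  qed
  have central: "m p f = m f p" if "f \<in> V" for f
  proof -
    have sv: "\<sigma> *\<^sub>R v \<in> V" and us: "u + \<sigma> *\<^sub>R v \<in> V"
      using V u(1) v(1) by (auto intro: subspace_scale subspace_add)
    show ?thesis
      unfolding p using that u v(1) sv us
      by (simp add: add_left add_right scale_left scale_right v(2)[OF that])
  qed
  have hom: "m (m f h) p = m (m f p) (m h p)" if "f \<in> V" "h \<in> V" for f h
  proof -
    have "m (m f p) (m h p) = m f (m (m p h) p)"
      using that by (simp add: assoc closed pV)
    also have "\<dots> = m f (m h (m p p))"
      using that by (simp add: assoc closed pV central[OF that(2)])
    finally show ?thesis
      using that by (simp add: assoc closed pV pp)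
  qed
  have "algebra_endomorphism V m (\<lambda>f. m f p)"
    unfolding algebra_endomorphism_def using pV by (auto simp: closed add_left scale_left hom)
  moreover have "subalgebra_of ((\<lambda>f. m f p) ` V) V m"
    unfolding subalgebra_of_def
  proof (intro conjI ballI)
    show "(\<lambda>f. m f p) ` V \<subseteq> V" using closed pV by auto
    show "subspace ((\<lambda>f. m f p) ` V)"
    proof (rule subspaceI)
      have "0 = m (0 *\<^sub>R u) p" using u pV scale_left[of u p 0] by simp
      then show "0 \<in> (\<lambda>f. m f p) ` V" using V subspace_scale u by blast
    next
      fix x y assume "x \<in> (\<lambda>f. m f p) ` V" "y \<in> (\<lambda>f. m f p) ` V"
      then obtain f h where "f \<in> V" "h \<in> V" "x = m f p" "y = m h p" by auto
      then show "x + y \<in> (\<lambda>f. m f p) ` V"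
        using V pV by (intro image_eqI[of _ _ "f + h"]) (auto simp: add_left subspace_add)
    next
      fix c x assume "x \<in> (\<lambda>f. m f p) ` V"
      then obtain f where "f \<in> V" "x = m f p" by auto
      then show "c *\<^sub>R x \<in> (\<lambda>f. m f p) ` V"
        using V pV by (intro image_eqI[of _ _ "c *\<^sub>R f"]) (auto simp: scale_left subspace_scale)
    qed
    fix x y assume "x \<in> (\<lambda>f. m f p) ` V" "y \<in> (\<lambda>f. m f p) ` V"
    then show "m x y \<in> (\<lambda>f. m f p) ` V"
      by (auto simp: hom[symmetric] closed)
  qed
  moreover have "is_unit_of p ((\<lambda>f. m f p) ` V) m"
    unfolding is_unit_of_def
  proof (intro conjI ballI)
    show "p \<in> (\<lambda>f. m f p) ` V" using pV pp by (intro image_eqI[of _ _ p]) auto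
    fix x assume "x \<in> (\<lambda>f. m f p) ` V"
    then obtain f where f: "f \<in> V" "x = m f p" by auto
    then show xp: "m x p = x" by (simp add: assoc pV pp)
    show "m p x = x" using f xp central[of x] closed pV by simp
  qed
  ultimately show ?thesis by blast
qed

section \<open>Exterior algebra of a vector space\<close>

text \<open>The wedge product, the contraction and, below, the coefficients only involve the values of forms at
one point, so they are studied for multicovectors of a single vector space.\<close>

definition wedge_at :: "'e multicovector \<Rightarrow> 'e multicovector \<Rightarrow> 'e multicovector" where
  "wedge_at \<alpha> \<beta> = (\<lambda>vs. \<Sum>S\<in>Pow {..<length vs}.
     (- 1) ^ inversions S * \<alpha> (nths vs S) * \<beta> (nths vs (- S)))"

definition interior_at :: "'e \<Rightarrow> 'e multicovector \<Rightarrow> 'e multicovector" where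
  "interior_at v \<alpha> = (\<lambda>vs. \<alpha> (v # vs))"

definition grade_involution :: "'e multicovector \<Rightarrow> 'e multicovector" where
  "grade_involution \<alpha> = (\<lambda>vs. (- 1) ^ length vs * \<alpha> vs)"

lemma wedge_apply: "wedge f h x = wedge_at (f x) (h x)"
  by (simp add: wedge_def wedge_at_def)

lemma contraction_apply: "contraction X f x = interior_at (X x) (f x)"
  by (simp add: contraction_def interior_at_def)

lemma wedge_at_Nil: "wedge_at \<alpha> \<beta> [] = \<alpha> [] * \<beta> []"
  by (simp add: wedge_at_def inversions_def)

lemma wedge_at_zero [simp]: "wedge_at 0 \<beta> = 0" "wedge_at \<alpha> 0 = 0"
  by (simp_all add: wedge_at_def fun_eq_iff)

lemma length_nths_le: "length (nths xs S) \<le> length xs"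
  by (simp add: length_nths card_mono[of "{..<length xs}", simplified] subset_eq)

lemma wedge_at_sum_left:
  assumes "\<And>ws. length ws \<le> length vs \<Longrightarrow> \<alpha> ws = (\<Sum>r\<in>R. c r * \<gamma> r ws)"
  shows "wedge_at \<alpha> \<beta> vs = (\<Sum>r\<in>R. c r * wedge_at (\<gamma> r) \<beta> vs)"
proof -
  have "wedge_at \<alpha> \<beta> vs = (\<Sum>S\<in>Pow {..<length vs}. \<Sum>r\<in>R.
      c r * ((- 1) ^ inversions S * \<gamma> r (nths vs S) * \<beta> (nths vs (- S))))"
    unfolding wedge_at_def
    by (intro sum.cong refl) (simp add: assms length_nths_le sum_distrib_left sum_distrib_right mult_ac)
  also have "\<dots> = (\<Sum>r\<in>R. c r * wedge_at (\<gamma> r) \<beta> vs)"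
    unfolding wedge_at_def sum_distrib_left by (rule sum.swap)
  finally show ?thesis .
qed

text \<open>The graded Leibniz rule for arguments of mixed degree: the grade involution collects the signs
\<open>(-1)\<^sup>r\<close>. Since the rule reduces the number of vectors, it drives the inductions on the wedge
product below.\<close>

lemma wedge_at_Cons:
  "wedge_at \<alpha> \<beta> (v # vs) =
     wedge_at (interior_at v \<alpha>) \<beta> vs + wedge_at (grade_involution \<alpha>) (interior_at v \<beta>) vs"
proof -
  \<comment> \<open>The Leibniz rule is known for homogeneous forms on a manifold; the degree parts are regarded as
    forms on a space with one point. Only finitely many of them matter for a given list of vectors.\<close>
  define f :: "nat \<Rightarrow> (unit, 'a) form" where "f r = degree_part r (\<lambda>_. \<alpha>)" for r
  let ?R = "{..Suc (length vs)}"
  have f: "is_form_of_degree r (f r)" for r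
    by (simp add: f_def is_form_of_degree_def degree_part_def)
  have step: "wedge_at (f r ()) \<beta> (v # vs) =
      wedge_at (interior_at v (f r ())) \<beta> vs + (- 1) ^ r * wedge_at (f r ()) (interior_at v \<beta>) vs" for r
    using contraction_wedge[OF f, of "\<lambda>_. v" r "\<lambda>_. \<beta>", THEN fun_cong, of "()", THEN fun_cong, of vs]
    by (simp add: contraction_apply wedge_apply) (simp add: interior_at_def)
  have "wedge_at \<alpha> \<beta> (v # vs) = (\<Sum>r\<in>?R. 1 * wedge_at (f r ()) \<beta> (v # vs))"
    by (rule wedge_at_sum_left) (auto simp: f_def degree_part_def)
  also have "\<dots> = (\<Sum>r\<in>?R. 1 * wedge_at (interior_at v (f r ())) \<beta> vs) +
      (\<Sum>r\<in>?R. (- 1) ^ r * wedge_at (f r ()) (interior_at v \<beta>) vs)"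
    by (simp add: step sum.distrib)
  also have "(\<Sum>r\<in>?R. 1 * wedge_at (interior_at v (f r ())) \<beta> vs) = wedge_at (interior_at v \<alpha>) \<beta> vs"
    by (rule wedge_at_sum_left[symmetric]) (auto simp: f_def degree_part_def interior_at_def)
  also have "(\<Sum>r\<in>?R. (- 1) ^ r * wedge_at (f r ()) (interior_at v \<beta>) vs) =
      wedge_at (grade_involution \<alpha>) (interior_at v \<beta>) vs"
  proof (rule wedge_at_sum_left[symmetric])
    fix ws :: "'a list" assume "length ws \<le> length vs"
    moreover have "(\<Sum>r\<in>?R. (- 1) ^ r * f r () ws) =
        (\<Sum>r\<in>?R. if r = length ws then (- 1) ^ length ws * \<alpha> ws else 0)"
      by (rule sum.cong) (auto simp: f_def degree_part_def)
    ultimately show "grade_involution \<alpha> ws = (\<Sum>r\<in>?R. (- 1) ^ r * f r () ws)"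
      by (simp add: grade_involution_def)
  qed
  finally show ?thesis .
qed

lemma alternating_linear:
  "alternating_multilinear \<alpha> \<Longrightarrow> linear (\<lambda>v. \<alpha> (us @ v # vs))"
  by (simp add: alternating_multilinear_def)

lemma alternating_eq_0:
  "alternating_multilinear \<alpha> \<Longrightarrow> \<not> distinct vs \<Longrightarrow> \<alpha> vs = 0"
  by (simp add: alternating_multilinear_def)

lemma bilinear_zero_diagonal_swap:
  fixes F :: "'e::real_vector \<Rightarrow> 'e \<Rightarrow> real"
  assumes "\<And>y. linear (\<lambda>x. F x y)" "\<And>x. linear (F x)" "\<And>x. F x x = 0"
  shows "F x y = - F y x"
proof -
  have "F (x + y) (x + y) = F x x + F x y + (F y x + F y y)"
    by (simp only: linear_add[OF assms(1)] linear_add[OF assms(2)] add_ac)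
  then show ?thesis
    by (simp add: assms(3))
qed

lemma alternating_swap:
  assumes "alternating_multilinear \<alpha>"
  shows "\<alpha> (us @ x # y # ws) = - \<alpha> (us @ y # x # ws)"
proof (rule bilinear_zero_diagonal_swap[of "\<lambda>x y. \<alpha> (us @ x # y # ws)"])
  show "linear (\<lambda>y. \<alpha> (us @ x # y # ws))" for x
    using alternating_linear[OF assms, of "us @ [x]" ws] by simp
qed (use assms in \<open>auto intro: alternating_linear alternating_eq_0\<close>)

lemma alternating_interior_at:
  assumes "alternating_multilinear \<alpha>"
  shows "alternating_multilinear (interior_at v \<alpha>)"
  unfolding alternating_multilinear_def interior_at_def
proof (intro conjI allI impI)
  fix us vs
  show "linear (\<lambda>w. \<alpha> (v # us @ w # vs))"
    using alternating_linear[OF assms, of "v # us" vs] by simp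
qed (simp add: alternating_eq_0[OF assms])

lemma alternating_grade_involution:
  assumes "alternating_multilinear \<alpha>"
  shows "alternating_multilinear (grade_involution \<alpha>)"
  unfolding alternating_multilinear_def grade_involution_def
proof (intro conjI allI impI)
  fix us vs
  show "linear (\<lambda>w. (- 1) ^ length (us @ w # vs) * \<alpha> (us @ w # vs))"
    using linear_compose_scale_right[OF alternating_linear[OF assms, of us vs],
        of "(- 1) ^ (length us + Suc (length vs))"] by simp
qed (simp add: alternating_eq_0[OF assms])

lemma interior_at_twice:
  assumes "alternating_multilinear \<alpha>"
  shows "interior_at v (interior_at v \<alpha>) = 0"
  by (simp add: interior_at_def fun_eq_iff alternating_eq_0[OF assms])

text \<open>In the summand of a set \<open>S\<close> of positions the vector \<open>v\<close> is an argument of exactly one factor.\<close>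

lemma wedge_at_multilinear:
  assumes "alternating_multilinear \<alpha>" "alternating_multilinear \<beta>"
  shows "linear (\<lambda>v. wedge_at \<alpha> \<beta> (us @ v # vs))"
proof -
  have "linear (\<lambda>v. (- 1) ^ inversions S * \<alpha> (nths (us @ v # vs) S) * \<beta> (nths (us @ v # vs) (- S)))"
    for S
  proof (cases "length us \<in> S")
    case True
    show ?thesis
      using True linear_compose_scale_right[OF alternating_linear[OF assms(1), of "nths us S"
            "nths vs {j. Suc j + length us \<in> S}"],
          of "(- 1) ^ inversions S * \<beta> (nths us (- S) @ nths vs {j. Suc j + length us \<notin> S})"]
      by (simp add: nths_append nths_Cons mult_ac)
  next
    case False
    show ?thesis
      using False linear_compose_scale_right[OF alternating_linear[OF assms(2), of "nths us (- S)"
            "nths vs {j. Suc j + length us \<notin> S}"],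
          of "(- 1) ^ inversions S * \<alpha> (nths us S @ nths vs {j. Suc j + length us \<in> S})"]
      by (simp add: nths_append nths_Cons mult_ac)
  qed
  then show ?thesis
    unfolding wedge_at_def by (simp add: linear_compose_sum)
qed

text \<open>By the Leibniz rule the double contraction of \<open>\<alpha> \<and> \<beta>\<close> with \<open>v\<close> leaves two mixed terms
\<open>(v\<rfloor>\<alpha>) \<and> (v\<rfloor>\<beta>)\<close>, with opposite signs because contraction anticommutes with the grade
involution.\<close>

lemma wedge_at_repeat:
  assumes "alternating_multilinear \<alpha>" "alternating_multilinear \<beta>"
  shows "wedge_at \<alpha> \<beta> (v # v # vs) = 0"
proof -
  have "grade_involution (interior_at v \<alpha>) = - interior_at v (grade_involution \<alpha>)"
    by (simp add: grade_involution_def interior_at_def fun_eq_iff)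
  moreover have "wedge_at (- \<gamma>) \<delta> vs = - wedge_at \<gamma> \<delta> vs" for \<gamma> \<delta>
    by (simp add: wedge_at_def sum_negf)
  ultimately show ?thesis
    using assms by (simp add: wedge_at_Cons interior_at_twice alternating_grade_involution)
qed

text \<open>If the repetition lies in the tail, contracting with the first vector reduces to shorter lists. If
the first vector is the repeated one, either it is repeated at once or it can be exchanged with
the second vector, which moves the repetition to the tail.\<close>

lemma wedge_at_not_distinct:
  assumes "alternating_multilinear \<alpha>" "alternating_multilinear \<beta>" "\<not> distinct vs"
  shows "wedge_at \<alpha> \<beta> vs = 0"
  using assms
proof (induction "length vs" arbitrary: \<alpha> \<beta> vs)
  case (Suc n)
  \<comment> \<open>Both terms of the Leibniz rule contain the tail, to which the induction hypothesis applies.\<close>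
  have tail: "wedge_at \<alpha> \<beta> (w # ws) = 0" if "length ws = n" "\<not> distinct ws" for w ws
    using Suc.prems(1,2) that Suc.hyps(1)[of ws]
    by (simp add: wedge_at_Cons alternating_interior_at alternating_grade_involution)
  obtain v vs' where vs: "vs = v # vs'" "length vs' = n"
    using Suc.hyps(2) by (cases vs) auto
  show ?case
  proof (cases "distinct vs'")
    case True
    then obtain us ws where split: "vs' = us @ v # ws"
      using Suc.prems(3) vs by (auto dest: split_list)
    show ?thesis
    proof (cases us)
      case Nil
      then show ?thesis using vs split wedge_at_repeat[OF Suc.prems(1,2)] by simp
    next
      case (Cons u us')
      let ?F = "\<lambda>x y. wedge_at \<alpha> \<beta> (x # y # us' @ v # ws)"
      have "?F v u = - ?F u v"
      proof (rule bilinear_zero_diagonal_swap[of ?F])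
        show "linear (\<lambda>x. ?F x y)" for y
          using wedge_at_multilinear[OF Suc.prems(1,2), of "[]"] by simp
        show "linear (?F x)" for x
          using wedge_at_multilinear[OF Suc.prems(1,2), of "[x]"] by simp
        show "?F x x = 0" for x
          by (rule wedge_at_repeat[OF Suc.prems(1,2)])
      qed
      also have "?F u v = 0"
        by (rule tail) (use vs split Cons in auto)
      finally show ?thesis using vs split Cons by simp
    qed
  qed (use tail vs in simp)
qed simp

lemma alternating_wedge_at:
  assumes "alternating_multilinear \<alpha>" "alternating_multilinear \<beta>"
  shows "alternating_multilinear (wedge_at \<alpha> \<beta>)"
  unfolding alternating_multilinear_def
  using wedge_at_multilinear[OF assms] wedge_at_not_distinct[OF assms] by blast

lemma alternating_zero: "alternating_multilinear 0"
  by (simp add: alternating_multilinear_def linear_zero)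

lemma alternating_add:
  assumes "alternating_multilinear \<alpha>" "alternating_multilinear \<beta>"
  shows "alternating_multilinear (\<alpha> + \<beta>)"
  unfolding alternating_multilinear_def
  using linear_compose_add[OF alternating_linear[OF assms(1)] alternating_linear[OF assms(2)]]
  by (simp add: alternating_eq_0[OF assms(1)] alternating_eq_0[OF assms(2)])

lemma alternating_scaleR:
  assumes "alternating_multilinear \<alpha>"
  shows "alternating_multilinear (a *\<^sub>R \<alpha>)"
  unfolding alternating_multilinear_def
  using linear_compose_scale_right[OF alternating_linear[OF assms], of a]
  by (simp add: alternating_eq_0[OF assms])

lemma alternating_degree_part:
  assumes "alternating_multilinear (f x)"
  shows "alternating_multilinear (degree_part r f x)"
  unfolding alternating_multilinear_def degree_part_def
proof (intro conjI allI impI)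
  fix us vs
  show "linear (\<lambda>v. if length (us @ v # vs) = r then f x (us @ v # vs) else 0)"
    using alternating_linear[OF assms, of us vs]
    by (cases "length us + Suc (length vs) = r") (simp_all add: linear_zero)
qed (simp add: alternating_eq_0[OF assms])

text \<open>A multicovector of degree 0 acts by multiplication, since only the empty set of positions
contributes.\<close>

lemma wedge_at_scalar: "wedge_at (\<lambda>vs. if vs = [] then c else 0) \<beta> vs = c * \<beta> vs"
proof -
  have empty: "nths vs S = [] \<longleftrightarrow> S = {}" if "S \<subseteq> {..<length vs}" for S
    using that by (auto simp: set_nths simp flip: set_empty)
  have "wedge_at (\<lambda>vs. if vs = [] then c else 0) \<beta> vs =
      (\<Sum>S\<in>Pow {..<length vs}. if S = {} then c * \<beta> vs else 0)"
    unfolding wedge_at_def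
    by (rule sum.cong) (auto simp: empty inversions_def nths_all)
  then show ?thesis by simp
qed

definition of_covector :: "('e \<Rightarrow> real) \<Rightarrow> 'e multicovector" where
  "of_covector \<theta> vs = (case vs of [w] \<Rightarrow> \<theta> w | _ \<Rightarrow> 0)"

lemma of_covector_eq_0: "length vs \<noteq> 1 \<Longrightarrow> of_covector \<theta> vs = 0"
  by (auto simp: of_covector_def split: list.splits)

lemma alternating_of_covector:
  fixes \<theta> :: "'e::euclidean_space \<Rightarrow> real"
  assumes "linear \<theta>"
  shows "alternating_multilinear (of_covector \<theta>)"
  unfolding alternating_multilinear_def
proof (intro conjI allI impI)
  fix us vs :: "'e list"
  show "linear (\<lambda>v. of_covector \<theta> (us @ v # vs))"
  proof (cases "us = [] \<and> vs = []")
    case True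
    then show ?thesis using assms by (simp add: of_covector_def)
  next
    case False
    then have "of_covector \<theta> (us @ v # vs) = 0" for v
      by (intro of_covector_eq_0) auto
    then show ?thesis by (simp add: linear_zero)
  qed
next
  fix vs :: "'e list" assume "\<not> distinct vs"
  then show "of_covector \<theta> vs = 0"
    by (auto simp: of_covector_def split: list.splits)
qed

section \<open>Coefficients of alternating forms\<close>

text \<open>The coefficient of \<open>\<alpha>\<close> at the monomial \<open>e\<^sup>K\<close>, when \<open>b\<close> is the basis dual to the \<open>e\<^sup>i\<close>.\<close>

definition coefficient :: "(nat \<Rightarrow> 'e) \<Rightarrow> 'e multicovector \<Rightarrow> nat set \<Rightarrow> real" where
  "coefficient b \<alpha> K = \<alpha> (map b (sorted_list_of_set K))"

lemma sorted_list_of_set_insert_min: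
  assumes "finite K" "\<forall>j\<in>K. k < j"
  shows "sorted_list_of_set (insert k K) = k # sorted_list_of_set (K::nat set)"
proof -
  have "k \<notin> K" using assms(2) by auto
  then show ?thesis
    using assms by (simp add: insort_is_Cons less_imp_le)
qed

lemma sum_Pow_insert:
  fixes F :: "'a set \<Rightarrow> real"
  assumes "finite K" "k \<notin> K"
  shows "(\<Sum>I\<in>Pow (insert k K). F I) = (\<Sum>I\<in>Pow K. F I + F (insert k I))"
proof -
  have "inj_on (insert k) (Pow K)"
    using assms(2) by (auto simp: inj_on_def)
  moreover have "Pow K \<inter> insert k ` Pow K = {}"
    using assms(2) by auto
  ultimately show ?thesis
    using assms(1) by (simp add: Pow_insert sum.union_disjoint sum.reindex sum.distrib)
qed

lemma coefficient_grade_involution: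
  "finite K \<Longrightarrow> coefficient b (grade_involution \<alpha>) K = (- 1) ^ card K * coefficient b \<alpha> K"
  by (simp add: coefficient_def grade_involution_def)

text \<open>By induction on \<open>K\<close>, adding a new least index. That index comes first in the list of arguments, so
the Leibniz rule applies to it: it joins \<open>I\<close> without a sign or its complement with one sign for
each element of \<open>I\<close>. On disjoint sets \<open>clifford_sign\<close> is the sign of the shuffle.\<close>

lemma coefficient_wedge_at:
  assumes "finite K"
  shows "coefficient b (wedge_at \<alpha> \<beta>) K =
    (\<Sum>I\<in>Pow K. clifford_sign p I (K - I) * coefficient b \<alpha> I * coefficient b \<beta> (K - I))"
  using assms
proof (induction K arbitrary: \<alpha> \<beta> rule: finite_linorder_min_induct)
  case empty
  then show ?case by (simp add: coefficient_def wedge_at_Nil)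
next
  case (insert k K)
  have k: "k \<notin> K" using insert by auto
  have coef: "coefficient b (interior_at (b k) \<gamma>) I = coefficient b \<gamma> (insert k I)" if "I \<subseteq> K" for I \<gamma>
  proof -
    have "finite I" "\<forall>j\<in>I. k < j" using that insert finite_subset by blast+
    then show ?thesis
      unfolding coefficient_def interior_at_def by (simp only: sorted_list_of_set_insert_min list.map)
  qed
  let ?T = "\<lambda>I. clifford_sign p I (insert k K - I) * coefficient b \<alpha> I * coefficient b \<beta> (insert k K - I)"
  have "coefficient b (wedge_at \<alpha> \<beta>) (insert k K) =
      coefficient b (wedge_at (interior_at (b k) \<alpha>) \<beta>) K +
      coefficient b (wedge_at (grade_involution \<alpha>) (interior_at (b k) \<beta>)) K"
    using insert.hyps unfolding coefficient_def
    by (simp only: sorted_list_of_set_insert_min list.map wedge_at_Cons)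
  also have "\<dots> = (\<Sum>I\<in>Pow K. ?T I + ?T (insert k I))"
    unfolding insert.IH sum.distrib[symmetric]
  proof (rule sum.cong[OF refl])
    fix I assume I: "I \<in> Pow K"
    then have fin: "finite I" "finite (K - I)" and kI: "k \<notin> I" "k \<notin> K - I"
      using insert.hyps k finite_subset by auto
    have none: "{j \<in> K - I. j < k} = {}" and all: "{i \<in> I. k < i} = I"
      using I insert.hyps by force+
    have s: "clifford_sign p {k} (K - I) = 1" "clifford_sign p I {k} = (- 1) ^ card I"
      using clifford_sign_singleton_left[OF fin(2) kI(2), of p, unfolded none]
        clifford_sign_singleton_right[OF fin(1) kI(1), of p, unfolded all] by simp_all
    have "insert k K - I = insert k (K - I)" "insert k K - insert k I = K - I"
      using k kI by auto
    then show "clifford_sign p I (K - I) * coefficient b (interior_at (b k) \<alpha>) I * coefficient b \<beta> (K - I) +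
        clifford_sign p I (K - I) * coefficient b (grade_involution \<alpha>) I *
          coefficient b (interior_at (b k) \<beta>) (K - I) = ?T I + ?T (insert k I)"
      using I fin kI s
      by (simp add: coef coefficient_grade_involution 
          clifford_sign_insert_left[OF fin(1) kI(1)] clifford_sign_insert_right[OF fin(2) kI(2)])
  qed
  also have "\<dots> = (\<Sum>I\<in>Pow (insert k K). ?T I)"
    using insert.hyps(1) k by (rule sum_Pow_insert[symmetric])
  finally show ?case .
qed

text \<open>Moving \<open>b\<^sub>i\<close> to its place in a sorted list takes one transposition for each smaller index.\<close>

lemma alternating_insort:
  assumes "alternating_multilinear \<alpha>" "sorted ks"
  shows "\<alpha> (us @ b i # map b ks) =
    (- 1) ^ length (filter (\<lambda>k. k < i) ks) * \<alpha> (us @ map b (insort i (ks::nat list)))"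
  using assms(2)
proof (induction ks arbitrary: us)
  case (Cons k ks)
  show ?case
  proof (cases "i \<le> k")
    case True
    then have "filter (\<lambda>k. k < i) (k # ks) = []"
      using Cons.prems by (auto simp: filter_empty_conv)
    then show ?thesis using True by simp
  next
    case False
    have "\<alpha> (us @ b i # map b (k # ks)) = - \<alpha> ((us @ [b k]) @ b i # map b ks)"
      using alternating_swap[OF assms(1), of us "b i" "b k" "map b ks"] by simp
    also have "\<alpha> ((us @ [b k]) @ b i # map b ks) =
        (- 1) ^ length (filter (\<lambda>k. k < i) ks) * \<alpha> ((us @ [b k]) @ map b (insort i ks))"
      by (rule Cons.IH) (use Cons.prems in simp)
    finally show ?thesis using False by simp
  qed
qed simp

lemma coefficient_interior_at:
  assumes "alternating_multilinear \<alpha>" "finite I"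
  shows "coefficient b (interior_at (b i) \<alpha>) I =
    (if i \<in> I then 0 else (- 1) ^ card {k \<in> I. k < i} * coefficient b \<alpha> (insert i I))"
proof (cases "i \<in> I")
  case True
  then have "\<not> distinct (map b (i # sorted_list_of_set I))"
    using assms(2) by auto
  then show ?thesis
    using True alternating_eq_0[OF assms(1)] by (simp add: coefficient_def interior_at_def)
next
  case False
  have "length (filter (\<lambda>k. k < i) (sorted_list_of_set I)) = card (set (filter (\<lambda>k. k < i) (sorted_list_of_set I)))"
    by (rule distinct_card[symmetric]) simp
  also have "set (filter (\<lambda>k. k < i) (sorted_list_of_set I)) = {k \<in> I. k < i}"
    using assms(2) by auto
  finally show ?thesis
    using False assms(2) alternating_insort[OF assms(1), of "sorted_list_of_set I" "[]" b i]
    by (simp add: coefficient_def interior_at_def)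
qed

lemma alternating_sort:
  assumes "alternating_multilinear \<alpha>"
  shows "\<exists>s. \<alpha> (us @ map b is) = s * \<alpha> (us @ map b (sort (is::nat list)))"
proof (induction "is" arbitrary: us)
  case Nil
  then show ?case by (auto intro: exI[of _ 1])
next
  case (Cons i "is")
  obtain s where "\<alpha> ((us @ [b i]) @ map b is) = s * \<alpha> ((us @ [b i]) @ map b (sort is))"
    using Cons.IH by blast
  moreover note alternating_insort[OF assms sorted_sort, of us b i "is"]
  ultimately show ?case
    by (auto simp: mult.assoc[symmetric])
qed

text \<open>Multilinearity reduces the arguments to vectors of the spanning family, and sorting these reduces
to coefficients.\<close>

lemma alternating_determined_by_coefficients:
  fixes b :: "nat \<Rightarrow> 'e::euclidean_space"
  assumes \<alpha>: "alternating_multilinear \<alpha>" and "finite N" and span: "span (b ` N) = UNIV"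
    and zero: "\<And>K. K \<subseteq> N \<Longrightarrow> coefficient b \<alpha> K = 0"
  shows "\<alpha> = 0"
proof -
  have basis: "\<alpha> (map b is) = 0" if "set is \<subseteq> N" for "is"
  proof (cases "distinct is")
    case True
    then have "sort is = sorted_list_of_set (set is)"
      by (simp add: sorted_list_of_set_sort_remdups distinct_remdups_id)
    then show ?thesis
      using alternating_sort[OF \<alpha>, of "[]" b "is"] zero[OF that] by (auto simp: coefficient_def)
  next
    case False
    then have "\<not> distinct (map b is)" by (simp add: distinct_map)
    then show ?thesis by (rule alternating_eq_0[OF \<alpha>])
  qed
  have "\<alpha> (map b is @ vs) = 0" if "set is \<subseteq> N" for "is" vs
    using that
  proof (induction vs arbitrary: "is")
    case Nil
    then show ?case using basis by simp
  next
    case (Cons v vs)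
    have "\<alpha> (map b is @ b i # vs) = 0" if "i \<in> N" for i
      using Cons.IH[of "is @ [i]"] Cons.prems that by simp
    then show ?case
      using linear_eq_0_on_span[OF alternating_linear[OF \<alpha>, of "map b is" vs], of "b ` N" v] span by auto
  qed
  from this[of "[]"] show ?thesis by (simp add: fun_eq_iff)
qed

section \<open>The Graf product is the Clifford product\<close>

lemma sum_fun_apply: "(\<Sum>i\<in>S. F i) x = (\<Sum>i\<in>S. F i x)"
  by (induction S rule: infinite_finite_induct) auto

lemma coefficient_degree_part:
  "finite I \<Longrightarrow> coefficient b (degree_part r f x) I = (if card I = r then coefficient b (f x) I else 0)"
  by (simp add: coefficient_def degree_part_def)

text \<open>The sign of the term of order \<open>l\<close> in the Graf product of an \<open>r\<close>-form with a form of degree at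
least \<open>r\<close>.\<close>

definition contraction_sign :: "nat \<Rightarrow> nat \<Rightarrow> real" where
  "contraction_sign l r = (- 1) ^ (l * (r - l) + l div 2)"

lemma contraction_sign_square: "contraction_sign l r * contraction_sign l r = 1"
  by (simp add: contraction_sign_def flip: power_add)

lemma neg_one_power_add_even: "(- 1 :: real) ^ (k + 2 * m) = (- 1) ^ k"
  by (simp add: power_add power_mult)

text \<open>The exponents on the two sides agree modulo 2 because \<open>[l/2] + [(l+1)/2] = l\<close>.\<close>

lemma contraction_sign_Suc:
  assumes "l \<le> r"
  shows "contraction_sign (Suc l) (Suc r) * (- 1) ^ r = contraction_sign l r"
proof -
  obtain d where d: "r = l + d" using assms le_Suc_ex by blast
  have "Suc l * d + Suc l div 2 + (l + d) = l * d + l div 2 + 2 * (d + Suc l div 2)"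
    by (simp add: algebra_simps)
  then have "(- 1 :: real) ^ (Suc l * d + Suc l div 2 + (l + d)) =
      (- 1) ^ (l * d + l div 2 + 2 * (d + Suc l div 2))"
    by (simp only:)
  also have "\<dots> = (- 1) ^ (l * d + l div 2)"
    by (rule neg_one_power_add_even)
  finally show ?thesis
    by (simp add: contraction_sign_def d power_add)
qed

text \<open>Restoring a contracted index \<open>i\<close> to both sets. The new pairs contribute \<open>g\<^sup>i\<^sup>i\<close>, one sign for each
element of \<open>J\<close> below \<open>i\<close> and one for each element of \<open>I\<close> above \<open>i\<close>; the latter are exchanged for
the elements of \<open>I\<close> below \<open>i\<close>, which occur in the coefficients of a contraction, at the cost
of \<open>(-1)\<close> to the power \<open>|I|\<close>.\<close>

lemma clifford_sign_contraction:
  fixes i :: nat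
  assumes "finite I" "finite J" "i \<notin> I" "i \<notin> J"
  shows "metric_sign p i * clifford_sign p I J *
      (- 1) ^ card {k \<in> I. k < i} * (- 1) ^ card {k \<in> J. k < i} =
    (- 1) ^ card I * clifford_sign p (insert i I) (insert i J)"
proof -
  have i: "clifford_sign p {i} {i} = metric_sign p i"
    by (simp add: clifford_sign_def)
  have "card I = card {k \<in> I. k < i} + card {k \<in> I. i < k}"
  proof -
    have "I = {k \<in> I. k < i} \<union> {k \<in> I. i < k}" using assms(3) by (auto simp: not_less order.order_iff_strict)
    moreover have "card ({k \<in> I. k < i} \<union> {k \<in> I. i < k}) = card {k \<in> I. k < i} + card {k \<in> I. i < k}"
      by (rule card_Un_disjoint) (use assms(1) in auto)
    ultimately show ?thesis by simp
  qed
  then have I: "(- 1 :: real) ^ card I = (- 1) ^ card {k \<in> I. k < i} * (- 1) ^ card {k \<in> I. i < k}"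
    by (simp only: power_add)
  have sq: "(- 1 :: real) ^ k * ((- 1) ^ k * y) = y" for k y
    by (simp flip: mult.assoc power_add)
  show ?thesis
    unfolding clifford_sign_insert_left[OF assms(1,3)] clifford_sign_insert_right[OF assms(2,4)]
      i clifford_sign_singleton_left[OF assms(2,4)] clifford_sign_singleton_right[OF assms(1,3)] I
    by (simp only: mult_ac sq)
qed

text \<open>The indices common to \<open>I\<close> and the symmetric difference of \<open>I\<close> and \<open>K\<close> form the set \<open>I - K\<close>, and
the product of order \<open>l\<close> only sees the terms in which these are \<open>l\<close> indices. In the induction step the
outer contraction may remove any of the \<open>l + 1\<close> common indices, with the same result each time;
this is where the factorial comes from.\<close>

lemma coefficient_contracted_wedge:
  fixes g :: "('m, 'e::euclidean_space) metric"
  defines "N \<equiv> {1..DIM('e)}"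
  assumes metric: "\<And>i j. i \<in> N \<Longrightarrow> j \<in> N \<Longrightarrow>
      inverse_metric g e i j x = (if i \<noteq> j then 0 else metric_sign p i)"
    and "alternating_multilinear (f x)" "alternating_multilinear (h x)" and K: "K \<subseteq> N"
  defines "coef \<equiv> coefficient (\<lambda>i. dual_frame e i x)"
  shows "coef (contracted_wedge g e l f h x) K =
    fact l * (\<Sum>I | I \<in> Pow N \<and> card (I - K) = l. contraction_sign l (card I) *
      clifford_sign p I (sym_diff I K) * coef (f x) I * coef (h x) (sym_diff I K))"
  using assms(3,4)
proof (induction l arbitrary: f h)
  case 0
  have fin: "finite K" using K finite_subset by (auto simp: N_def)
  have "{I. I \<in> Pow N \<and> card (I - K) = 0} = Pow K"
    using K finite_subset[of _ N] by (auto simp: N_def)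
  moreover have "sym_diff I K = K - I" if "I \<in> Pow K" for I
    using that by auto
  ultimately show ?case
    using coefficient_wedge_at[OF fin, of "\<lambda>i. dual_frame e i x" "f x" "h x" p]
    by (simp add: coef_def wedge_apply contraction_sign_def)
next
  case (Suc l)
  let ?b = "\<lambda>i. dual_frame e i x"
  let ?s = "clifford_sign p"
  let ?A = "\<lambda>l. {I. I \<in> Pow N \<and> card (I - K) = l}"
  \<comment> \<open>\<open>T i I\<close> is the term of \<open>I\<close> after contracting both factors with \<open>e\<^sub>i\<close>; \<open>G\<close> is the term of the set
    to which \<open>i\<close> has been restored. The two agree up to the metric sign.\<close>
  define G where "G I = contraction_sign (Suc l) (card I) * ?s I (sym_diff I K) *
      coef (f x) I * coef (h x) (sym_diff I K)" for I
  define T where "T i I = contraction_sign l (card I) * ?s I (sym_diff I K) *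
      coef (interior_at (?b i) (f x)) I * coef (interior_at (?b i) (h x)) (sym_diff I K)" for i I
  have finN: "finite N" by (simp add: N_def)
  then have fin: "finite I" if "I \<subseteq> N" for I using that finite_subset by blast
  have inner: "(\<Sum>I\<in>?A l. metric_sign p i * T i I) =
      (\<Sum>I | I \<in> ?A (Suc l) \<and> i \<in> I - K. G I)" if i: "i \<in> N" for i
  proof -
    note interior = coefficient_interior_at[where b = ?b and i = i]
    have "(\<Sum>I\<in>?A l. metric_sign p i * T i I) =
        (\<Sum>I | I \<in> ?A l \<and> i \<notin> I \<and> i \<notin> K. metric_sign p i * T i I)"
    \<comment> \<open>Contracting with \<open>e\<^sub>i\<close> annihilates the coefficients at the sets that contain \<open>i\<close>.\<close>
    proof (rule sum.mono_neutral_right)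
      show "\<forall>I\<in>?A l - {I \<in> ?A l. i \<notin> I \<and> i \<notin> K}. metric_sign p i * T i I = 0"
      proof
        fix I assume I: "I \<in> ?A l - {I \<in> ?A l. i \<notin> I \<and> i \<notin> K}"
        then have "finite I" "finite (sym_diff I K)" and "i \<in> I \<or> i \<in> sym_diff I K"
          using fin K by auto
        then show "metric_sign p i * T i I = 0"
          using Suc.prems unfolding T_def coef_def by (auto simp: interior)
      qed
    qed (use finN in auto)
    also have "\<dots> = (\<Sum>I | I \<in> ?A (Suc l) \<and> i \<in> I - K. G I)"
    proof (rule sum.reindex_bij_witness[of _ "\<lambda>I. I - {i}" "insert i"])
      fix I assume I: "I \<in> {I. I \<in> ?A l \<and> i \<notin> I \<and> i \<notin> K}"
      then have IN: "I \<subseteq> N" and l: "card (I - K) = l" and iI: "i \<notin> I" "i \<notin> K" by auto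
      have fI: "finite I" "finite (sym_diff I K)" using fin IN K by auto
      have iD: "i \<notin> sym_diff I K" using iI by auto
      have D: "sym_diff (insert i I) K = insert i (sym_diff I K)" using iI by auto
      have D': "insert i I - K = insert i (I - K)" using iI by auto
      show "insert i I \<in> {I. I \<in> ?A (Suc l) \<and> i \<in> I - K}"
        using IN i l iI fI by (simp add: D')
      show "insert i I - {i} = I" using iI by auto
      have "l \<le> card I" using l fI(1) by (metis Diff_subset card_mono)
      then have sign: "contraction_sign l (card I) = contraction_sign (Suc l) (Suc (card I)) * (- 1) ^ card I"
        by (rule contraction_sign_Suc[symmetric])
      have sq: "(- 1 :: real) ^ k * ((- 1) ^ k * y) = y" for k y
        by (simp flip: mult.assoc power_add)
      have "metric_sign p i * T i I = contraction_sign l (card I) *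
          (metric_sign p i * ?s I (sym_diff I K) * (- 1) ^ card {k \<in> I. k < i} *
            (- 1) ^ card {k \<in> sym_diff I K. k < i}) *
          coef (f x) (insert i I) * coef (h x) (insert i (sym_diff I K))"
        unfolding T_def coef_def interior[OF Suc.prems(1) fI(1)]
          interior[OF Suc.prems(2) fI(2)] if_not_P[OF iI(1)] if_not_P[OF iD]
        by (simp only: mult_ac)
      also have "\<dots> = G (insert i I)"
        unfolding clifford_sign_contraction[OF fI iI(1) iD] G_def D sign
          card_insert_disjoint[OF fI(1) iI(1)]
        by (simp only: mult_ac sq)
      finally show "G (insert i I) = metric_sign p i * T i I" by simp
    next
      fix I assume I: "I \<in> {I. I \<in> ?A (Suc l) \<and> i \<in> I - K}"
      then have "I - {i} - K = I - K - {i}" "finite (I - K)" using fin by auto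
      with I show "I - {i} \<in> {I. I \<in> ?A l \<and> i \<notin> I \<and> i \<notin> K}" by auto
      show "insert i (I - {i}) = I" using I by auto
    qed
    finally show ?thesis .
  qed
  have "contracted_wedge g e (Suc l) f h x = (\<Sum>i\<in>N. metric_sign p i *\<^sub>R
      contracted_wedge g e l (contraction (dual_frame e i) f) (contraction (dual_frame e i) h) x)"
  proof -
    have "contracted_wedge g e (Suc l) f h x = (\<Sum>i\<in>N. \<Sum>j\<in>N. inverse_metric g e i j x *\<^sub>R
        contracted_wedge g e l (contraction (dual_frame e i) f) (contraction (dual_frame e j) h) x)"
      by (simp add: N_def sum_fun_apply)
    also have "\<dots> = (\<Sum>i\<in>N. \<Sum>j\<in>N. if j = i then metric_sign p i *\<^sub>R
        contracted_wedge g e l (contraction (dual_frame e i) f) (contraction (dual_frame e j) h) x else 0)"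
      by (intro sum.cong refl) (auto simp: metric)
    finally show ?thesis using finN by simp
  qed
  then have "coef (contracted_wedge g e (Suc l) f h x) K = (\<Sum>i\<in>N. metric_sign p i *
      coef (contracted_wedge g e l (contraction (dual_frame e i) f) (contraction (dual_frame e i) h) x) K)"
    by (simp add: coef_def coefficient_def sum_fun_apply)
  also have "\<dots> = (\<Sum>i\<in>N. fact l * (\<Sum>I\<in>?A l. metric_sign p i * T i I))"
  proof (rule sum.cong[OF refl])
    fix i
    have "coef (contracted_wedge g e l (contraction (dual_frame e i) f) (contraction (dual_frame e i) h) x) K =
        fact l * (\<Sum>I\<in>?A l. T i I)"
      unfolding T_def
      by (subst Suc.IH) (use Suc.prems in \<open>simp_all add: contraction_apply alternating_interior_at\<close>)
    then show "metric_sign p i * coef (contracted_wedge g e l (contraction (dual_frame e i) f)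
        (contraction (dual_frame e i) h) x) K = fact l * (\<Sum>I\<in>?A l. metric_sign p i * T i I)"
      by (simp add: sum_distrib_left mult_ac)
  qed
  also have "\<dots> = fact l * (\<Sum>i\<in>N. \<Sum>I | I \<in> ?A (Suc l) \<and> i \<in> I - K. G I)"
    unfolding sum_distrib_left[of "fact l" _ N] by (rule sum.cong[OF refl]) (simp only: inner)
  also have "(\<Sum>i\<in>N. \<Sum>I | I \<in> ?A (Suc l) \<and> i \<in> I - K. G I) = (\<Sum>I\<in>?A (Suc l). \<Sum>i | i \<in> N \<and> i \<in> I - K. G I)"
    by (rule sum.swap_restrict) (use finN in auto)
  also have "\<dots> = (\<Sum>I\<in>?A (Suc l). real (Suc l) * G I)"
  proof (rule sum.cong[OF refl])
    fix I assume I: "I \<in> ?A (Suc l)"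
    then have "{i. i \<in> N \<and> i \<in> I - K} = I - K" by auto
    then show "(\<Sum>i | i \<in> N \<and> i \<in> I - K. G I) = real (Suc l) * G I" using I by simp
  qed
  finally show ?case
    unfolding G_def by (simp add: sum_distrib_left mult_ac)
qed

text \<open>Sorting the sets \<open>I\<close> by the number of their common indices collects the contracted wedge products of
all orders into one sum.\<close>

lemma sum_by_overlap:
  fixes Q :: "'a set \<Rightarrow> real"
  assumes "finite N" "\<And>I. I \<subseteq> N \<Longrightarrow> k < card (I - K) \<Longrightarrow> Q I = 0"
  shows "(\<Sum>l=0..k. \<Sum>I | I \<in> Pow N \<and> card (I - K) = l. Q I) = (\<Sum>I\<in>Pow N. Q I)"
proof -
  have "(\<Sum>l=0..k. \<Sum>I | I \<in> Pow N \<and> card (I - K) = l. Q I) =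
      (\<Sum>I\<in>Pow N. \<Sum>l | l \<in> {0..k} \<and> card (I - K) = l. Q I)"
    by (rule sum.swap_restrict) (use assms in auto)
  also have "\<dots> = (\<Sum>I\<in>Pow N. Q I)"
  proof (rule sum.cong[OF refl])
    fix I assume I: "I \<in> Pow N"
    have "{l. l \<in> {0..k} \<and> card (I - K) = l} = (if card (I - K) \<le> k then {card (I - K)} else {})"
      by auto
    then show "(\<Sum>l | l \<in> {0..k} \<and> card (I - K) = l. Q I) = Q I"
      using assms(2)[of I] I by simp
  qed
  finally show ?thesis .
qed

text \<open>For \<open>r \<le> s\<close> the sign in the Graf product cancels the one in \<open>coefficient_contracted_wedge\<close>. For
\<open>r > s\<close> the contracted products have their factors exchanged; what remains of the signs is
\<open>(-1)\<^sup>r\<^sup>s\<^sup>+\<^sup>l\<close>, which is exactly the effect of exchanging the arguments of \<open>clifford_sign\<close>.\<close>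

lemma coefficient_graf_homogeneous:
  fixes g :: "('m, 'e::euclidean_space) metric"
  defines "N \<equiv> {1..DIM('e)}"
  assumes metric: "\<And>i j. i \<in> N \<Longrightarrow> j \<in> N \<Longrightarrow>
      inverse_metric g e i j x = (if i \<noteq> j then 0 else metric_sign p i)"
    and f: "alternating_multilinear (f x)" and h: "alternating_multilinear (h x)" and K: "K \<subseteq> N"
  defines "coef \<equiv> coefficient (\<lambda>i. dual_frame e i x)"
  assumes r: "\<And>I. I \<subseteq> N \<Longrightarrow> card I \<noteq> r \<Longrightarrow> coef (f x) I = 0"
    and s: "\<And>I. I \<subseteq> N \<Longrightarrow> card I \<noteq> s \<Longrightarrow> coef (h x) I = 0"
  shows "coef (graf_homogeneous g e r s f h x) K = clifford_mult p N (coef (f x)) (coef (h x)) K"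
proof -
  define Q where "Q I = clifford_sign p I (sym_diff I K) * coef (f x) I * coef (h x) (sym_diff I K)" for I
  have finN: "finite N" by (simp add: N_def)
  then have fin: "finite I" if "I \<subseteq> N" for I using that finite_subset by blast
  have cw: "coef (contracted_wedge g e l f' h' x) K =
      fact l * (\<Sum>I | I \<in> Pow N \<and> card (I - K) = l. contraction_sign l (card I) *
        clifford_sign p I (sym_diff I K) * coef (f' x) I * coef (h' x) (sym_diff I K))"
    if "alternating_multilinear (f' x)" "alternating_multilinear (h' x)" for l f' h'
    unfolding N_def coef_def
    by (rule coefficient_contracted_wedge) (use metric that K in \<open>auto simp: N_def\<close>)
  have sqd: "c * (c * y) = y" if "c * c = 1" for c y :: real
    using that by (simp flip: mult.assoc)
  have Q: "clifford_mult p N (coef (f x)) (coef (h x)) K = (\<Sum>I\<in>Pow N. Q I)"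
    by (simp add: clifford_mult_def Q_def)
  show ?thesis
  proof (cases "r \<le> s")
    case True
    have "coef (graf_homogeneous g e r s f h x) K =
        (\<Sum>l=0..r. contraction_sign l r / fact l * coef (contracted_wedge g e l f h x) K)"
      using True by (simp add: graf_homogeneous_def coef_def coefficient_def sum_fun_apply contraction_sign_def)
    also have "\<dots> = (\<Sum>l=0..r. \<Sum>I | I \<in> Pow N \<and> card (I - K) = l. Q I)"
    proof (rule sum.cong[OF refl])
      fix l
      have "contraction_sign l r / fact l * coef (contracted_wedge g e l f h x) K =
          (\<Sum>I | I \<in> Pow N \<and> card (I - K) = l. contraction_sign l r * (contraction_sign l (card I) *
            clifford_sign p I (sym_diff I K) * coef (f x) I * coef (h x) (sym_diff I K)))"
        by (simp add: cw[of f h, OF f h] sum_distrib_left mult.assoc)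
      also have "\<dots> = (\<Sum>I | I \<in> Pow N \<and> card (I - K) = l. Q I)"
      proof (rule sum.cong[OF refl])
        fix I assume "I \<in> {I. I \<in> Pow N \<and> card (I - K) = l}"
        then show "contraction_sign l r * (contraction_sign l (card I) *
            clifford_sign p I (sym_diff I K) * coef (f x) I * coef (h x) (sym_diff I K)) = Q I"
          using r[of I] sqd[OF contraction_sign_square, of l r]
          by (cases "card I = r") (simp_all add: Q_def mult.assoc)
      qed
      finally show "contraction_sign l r / fact l * coef (contracted_wedge g e l f h x) K =
          (\<Sum>I | I \<in> Pow N \<and> card (I - K) = l. Q I)" .
    qed
    also have "\<dots> = (\<Sum>I\<in>Pow N. Q I)"
    proof (rule sum_by_overlap[OF finN])
      fix I assume I: "I \<subseteq> N" "r < card (I - K)"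
      then have "card I \<noteq> r"
        using card_mono[OF fin[OF I(1)], of "I - K"] by auto
      then show "Q I = 0" using r[of I] I by (simp add: Q_def)
    qed
    finally show ?thesis by (simp add: Q)
  next
    case False
    have "coef (graf_homogeneous g e r s f h x) K =
        (\<Sum>l=0..s. (- 1) ^ (r * s) * (- 1) ^ (l * (s - l + 1) + l div 2) / fact l *
          coef (contracted_wedge g e l h f x) K)"
      using False by (simp add: graf_homogeneous_def coef_def coefficient_def sum_fun_apply sum_distrib_left mult.assoc)
    also have "\<dots> = (\<Sum>l=0..s. \<Sum>I | I \<in> Pow N \<and> card (I - K) = l. Q I)"
    proof (rule sum.cong[OF refl])
      fix l
      let ?c = "(- 1 :: real) ^ (r * s) * (- 1) ^ (l * (s - l + 1) + l div 2)"
      have "?c / fact l * coef (contracted_wedge g e l h f x) K =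
          (\<Sum>J | J \<in> Pow N \<and> card (J - K) = l. ?c * (contraction_sign l (card J) *
            clifford_sign p J (sym_diff J K) * coef (h x) J * coef (f x) (sym_diff J K)))"
        by (simp add: cw[of h f, OF h f] sum_distrib_left mult.assoc)
      also have "\<dots> = (\<Sum>I | I \<in> Pow N \<and> card (I - K) = l. Q I)"
      \<comment> \<open>The factors are exchanged, so the sum runs over the index set of the second factor.\<close>
      proof (rule sum.reindex_bij_witness[of _ "\<lambda>I. sym_diff I K" "\<lambda>J. sym_diff J K"])
        fix J assume J: "J \<in> {J. J \<in> Pow N \<and> card (J - K) = l}"
        show "sym_diff (sym_diff J K) K = J" by auto
        have "sym_diff J K - K = J - K" by auto
        then show "sym_diff J K \<in> {I. I \<in> Pow N \<and> card (I - K) = l}"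
          using J K by auto
        let ?I = "sym_diff J K"
        have D: "sym_diff ?I K = J" by auto
        \<comment> \<open>Thus the overlap has \<open>l\<close> elements, which gives the \<open>l\<close> in the sign of the exchange.\<close>
        have IJ: "?I \<inter> J = J - K" by auto
        have IN: "?I \<subseteq> N" "J \<subseteq> N" using J K by auto
        show "Q (sym_diff J K) = ?c * (contraction_sign l (card J) *
            clifford_sign p J (sym_diff J K) * coef (h x) J * coef (f x) (sym_diff J K))"
        proof (cases "card ?I = r \<and> card J = s")
          case True
          have "l \<le> s" using J True card_mono[OF fin[OF IN(2)], of "J - K"] by auto
          have "?c * contraction_sign l (card J) = (- 1) ^ (r * s + l)"
          proof -
            have "r * s + (l * (s - l + 1) + l div 2) + (l * (s - l) + l div 2) =
                r * s + l + 2 * (l * (s - l) + l div 2)" by (simp add: algebra_simps)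
            then have "(- 1 :: real) ^ (r * s + (l * (s - l + 1) + l div 2) + (l * (s - l) + l div 2)) =
                (- 1) ^ (r * s + l + 2 * (l * (s - l) + l div 2))"
              by (simp only:)
            also have "\<dots> = (- 1) ^ (r * s + l)"
              by (rule neg_one_power_add_even)
            finally show ?thesis
              using True by (simp only: contraction_sign_def power_add)
          qed
          also have "\<dots> = clifford_sign p ?I J * clifford_sign p J ?I"
            using clifford_sign_commute[OF fin[OF IN(1)] fin[OF IN(2)], of p] True J by (simp add: IJ)
          finally have c: "?c * contraction_sign l (card J) = clifford_sign p ?I J * clifford_sign p J ?I" .
          have "?c * (contraction_sign l (card J) * clifford_sign p J ?I * coef (h x) J * coef (f x) ?I) =
              (?c * contraction_sign l (card J)) * clifford_sign p J ?I * (coef (f x) ?I * coef (h x) J)"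
            by (simp only: mult_ac)
          also have "\<dots> = clifford_sign p ?I J * (clifford_sign p J ?I * clifford_sign p J ?I) *
              (coef (f x) ?I * coef (h x) J)"
            unfolding c by (simp only: mult_ac)
          finally show ?thesis
            unfolding Q_def D clifford_sign_square by (simp only: mult_ac mult_1_right)
        next
          case False
          then have "coef (f x) ?I = 0 \<or> coef (h x) J = 0" using r[OF IN(1)] s[OF IN(2)] by blast
          then show ?thesis unfolding Q_def D by auto
        qed
      next
        fix I assume I: "I \<in> {I. I \<in> Pow N \<and> card (I - K) = l}"
        show "sym_diff (sym_diff I K) K = I" by auto
        have "sym_diff I K - K = I - K" by auto
        then show "sym_diff I K \<in> {J. J \<in> Pow N \<and> card (J - K) = l}"
          using I K by auto
      qed
      finally show "?c / fact l * coef (contracted_wedge g e l h f x) K =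
          (\<Sum>I | I \<in> Pow N \<and> card (I - K) = l. Q I)" .
    qed
    also have "\<dots> = (\<Sum>I\<in>Pow N. Q I)"
    proof (rule sum_by_overlap[OF finN])
      fix I assume I: "I \<subseteq> N" "s < card (I - K)"
      have D: "sym_diff I K \<subseteq> N" using I K by auto
      have "I - K \<subseteq> sym_diff I K" by auto
      then have "card (sym_diff I K) \<noteq> s"
        using I(2) card_mono[OF fin[OF D], of "I - K"] by linarith
      then show "Q I = 0" using s[OF D] by (simp add: Q_def)
    qed
    finally show ?thesis by (simp add: Q)
  qed
qed

lemma coefficient_graf:
  fixes g :: "('m, 'e::euclidean_space) metric"
  defines "N \<equiv> {1..DIM('e)}"
  assumes metric: "\<And>i j. i \<in> N \<Longrightarrow> j \<in> N \<Longrightarrow>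
      inverse_metric g e i j x = (if i \<noteq> j then 0 else metric_sign p i)"
    and f: "alternating_multilinear (f x)" and h: "alternating_multilinear (h x)" and K: "K \<subseteq> N"
  defines "coef \<equiv> coefficient (\<lambda>i. dual_frame e i x)"
  shows "coef (graf g e f h x) K = clifford_mult p N (coef (f x)) (coef (h x)) K"
proof -
  let ?n = "DIM('e)"
  have finN: "finite N" by (simp add: N_def)
  then have fin: "finite I" if "I \<subseteq> N" for I using that finite_subset by blast
  have card: "card I \<le> ?n" if "I \<subseteq> N" for I
    using card_mono[OF finN that] by (simp add: N_def)
  have "coef (graf g e f h x) K = (\<Sum>r=0..?n. \<Sum>s=0..?n.
      coef (graf_homogeneous g e r s (degree_part r f) (degree_part s h) x) K)"
    by (simp add: graf_def coef_def coefficient_def sum_fun_apply)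
  also have "\<dots> = (\<Sum>r=0..?n. \<Sum>s=0..?n.
      clifford_mult p N (coef (degree_part r f x)) (coef (degree_part s h x)) K)"
    unfolding N_def coef_def
    by (intro sum.cong refl coefficient_graf_homogeneous)
       (use metric K f h fin in \<open>auto simp: N_def alternating_degree_part coefficient_degree_part\<close>)
  also have "\<dots> = (\<Sum>r=0..?n. \<Sum>s=0..?n. \<Sum>I\<in>Pow N. clifford_sign p I (sym_diff I K) *
      (if card I = r then coef (f x) I else 0) *
      (if card (sym_diff I K) = s then coef (h x) (sym_diff I K) else 0))"
    unfolding clifford_mult_def coef_def
    by (intro sum.cong refl) (use fin K in \<open>auto simp: coefficient_degree_part\<close>)
  also have "\<dots> = (\<Sum>I\<in>Pow N. \<Sum>r=0..?n. \<Sum>s=0..?n. clifford_sign p I (sym_diff I K) *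
      (if card I = r then coef (f x) I else 0) *
      (if card (sym_diff I K) = s then coef (h x) (sym_diff I K) else 0))"
    by (subst sum.swap[of _ "Pow N"]) (subst sum.swap[of _ "{0..?n}" "Pow N"], rule refl)
  also have "\<dots> = (\<Sum>I\<in>Pow N. clifford_sign p I (sym_diff I K) * coef (f x) I * coef (h x) (sym_diff I K))"
  proof (rule sum.cong[OF refl])
    fix I assume "I \<in> Pow N"
    then have "card I \<le> ?n" "card (sym_diff I K) \<le> ?n"
      using card[of I] card[of "sym_diff I K"] K by auto
    then show "(\<Sum>r=0..?n. \<Sum>s=0..?n. clifford_sign p I (sym_diff I K) *
      (if card I = r then coef (f x) I else 0) *
      (if card (sym_diff I K) = s then coef (h x) (sym_diff I K) else 0)) =
      clifford_sign p I (sym_diff I K) * coef (f x) I * coef (h x) (sym_diff I K)"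
      by (simp flip: sum_distrib_left sum_distrib_right)
  qed
  finally show ?thesis by (simp add: clifford_mult_def)
qed

section \<open>Smooth functions on open sets\<close>

lemma Ck_on_cong:
  assumes "open S" "\<And>x. x \<in> S \<Longrightarrow> f x = g x" "Ck_on k S f"
  shows "Ck_on k S g"
  using assms(2,3)
proof (induction k arbitrary: f g)
  case 0
  then show ?case using continuous_on_cong[of S S f g] by simp
next
  case (Suc k)
  have diff: "f differentiable (at x)" if "x \<in> S" for x
    using Suc.prems(2) that by simp
  have "g differentiable (at x)" if "x \<in> S" for x
    using diff[OF that] has_derivative_transform_within_open[of f _ x UNIV S g] assms(1) that Suc.prems(1)
    unfolding differentiable_def by blast
  moreover have "Ck_on k S (\<lambda>x. frechet_derivative g (at x) v)" for v
  proof (rule Suc.IH)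
    show "frechet_derivative f (at x) v = frechet_derivative g (at x) v" if "x \<in> S" for x
      by (rule fun_cong[OF frechet_derivative_transform_within_open[OF diff[OF that] assms(1) that Suc.prems(1)]])
    show "Ck_on k S (\<lambda>x. frechet_derivative f (at x) v)" using Suc.prems(2) by simp
  qed
  ultimately show ?case by simp
qed

lemma Ck_on_differentiable: "Ck_on (Suc k) S f \<Longrightarrow> x \<in> S \<Longrightarrow> f differentiable (at x)"
  by simp

lemma Ck_on_continuous: "Ck_on k S f \<Longrightarrow> continuous_on S f"
  by (cases k) (auto intro!: continuous_at_imp_continuous_on differentiable_imp_continuous_within)

lemma Ck_on_Suc_imp: "Ck_on (Suc k) S f \<Longrightarrow> Ck_on k S f"
proof (induction k arbitrary: f)
  case 0
  then show ?case using Ck_on_continuous[of "Suc 0" S f] by simp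
next
  case (Suc k)
  then show ?case by (simp del: Ck_on.simps(1)) 
qed

lemma Ck_on_const: "Ck_on k S (\<lambda>x. c)"
  by (induction k arbitrary: c) auto

lemma Ck_on_add:
  assumes "open S" "Ck_on k S f" "Ck_on k S g"
  shows "Ck_on k S (\<lambda>x. f x + g x)"
  using assms(2,3)
proof (induction k arbitrary: f g)
  case (Suc k)
  have d: "((\<lambda>x. f x + g x) has_derivative
      (\<lambda>v. frechet_derivative f (at x) v + frechet_derivative g (at x) v)) (at x)" if "x \<in> S" for x
    using Suc.prems that by (intro has_derivative_add) (auto simp flip: frechet_derivative_works)
  have "Ck_on k S (\<lambda>x. frechet_derivative (\<lambda>x. f x + g x) (at x) v)" for v
  proof (rule Ck_on_cong[OF assms(1)])
    show "Ck_on k S (\<lambda>x. frechet_derivative f (at x) v + frechet_derivative g (at x) v)"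
      by (rule Suc.IH) (use Suc.prems in auto)
  qed (simp flip: frechet_derivative_at[OF d])
  then show ?case
    using d by (auto simp: differentiable_def)
qed (auto intro: continuous_intros)

text \<open>The derivative of a product is a sum of products of \<open>C\<^sup>k\<close> functions.\<close>

lemma Ck_on_mult:
  fixes f g :: "'a::euclidean_space \<Rightarrow> real"
  assumes "open S" "Ck_on k S f" "Ck_on k S g"
  shows "Ck_on k S (\<lambda>x. f x * g x)"
  using assms(2,3)
proof (induction k arbitrary: f g)
  case (Suc k)
  have d: "((\<lambda>x. f x * g x) has_derivative
      (\<lambda>v. f x * frechet_derivative g (at x) v + frechet_derivative f (at x) v * g x)) (at x)"
    if "x \<in> S" for x
    using Suc.prems that by (intro has_derivative_mult) (auto simp flip: frechet_derivative_works)
  have "Ck_on k S (\<lambda>x. frechet_derivative (\<lambda>x. f x * g x) (at x) v)" for v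
  proof (rule Ck_on_cong[OF assms(1)])
    show "Ck_on k S (\<lambda>x. f x * frechet_derivative g (at x) v + frechet_derivative f (at x) v * g x)"
      by (intro Ck_on_add[OF assms(1)] Suc.IH) (use Suc.prems Ck_on_Suc_imp in auto)
  qed (simp flip: frechet_derivative_at[OF d])
  then show ?case
    using d by (auto simp: differentiable_def)
qed (auto intro: continuous_intros)

text \<open>The derivative of \<open>1/f\<close> is a product of \<open>C\<^sup>k\<close> functions, one of which is \<open>1/f\<close> itself.\<close>

lemma Ck_on_inverse:
  fixes f :: "'a::euclidean_space \<Rightarrow> real"
  assumes "open S" "\<And>x. x \<in> S \<Longrightarrow> f x \<noteq> 0" "Ck_on k S f"
  shows "Ck_on k S (\<lambda>x. inverse (f x))"
  using assms(3)
proof (induction k)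
  case 0
  then show ?case using assms(2) by (auto intro!: continuous_intros)
next
  case (Suc k)
  have d: "((\<lambda>x. inverse (f x)) has_derivative
      (\<lambda>v. - (inverse (f x) * frechet_derivative f (at x) v * inverse (f x)))) (at x)"
    if "x \<in> S" for x
    using Suc.prems assms(2) that
    by (intro Deriv.has_derivative_inverse) (auto simp flip: frechet_derivative_works)
  have "Ck_on k S (\<lambda>x. frechet_derivative (\<lambda>x. inverse (f x)) (at x) v)" for v
  proof (rule Ck_on_cong[OF assms(1)])
    have IH: "Ck_on k S (\<lambda>x. inverse (f x))" using Suc.IH Ck_on_Suc_imp[OF Suc.prems] .
    show "Ck_on k S (\<lambda>x. - 1 * (inverse (f x) * frechet_derivative f (at x) v * inverse (f x)))"
      by (intro Ck_on_mult[OF assms(1)] IH Ck_on_const) (use Suc.prems in auto)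
  qed (simp flip: frechet_derivative_at[OF d])
  then show ?case
    using d by (auto simp: differentiable_def)
qed

lemma smooth_on_cong: "open S \<Longrightarrow> (\<And>x. x \<in> S \<Longrightarrow> f x = g x) \<Longrightarrow> smooth_on S f \<Longrightarrow> smooth_on S g"
  unfolding smooth_on_def using Ck_on_cong by blast

lemma smooth_on_const: "smooth_on S (\<lambda>x. c)"
  by (simp add: smooth_on_def Ck_on_const)

lemma smooth_on_add:
  "open S \<Longrightarrow> smooth_on S f \<Longrightarrow> smooth_on S g \<Longrightarrow> smooth_on S (\<lambda>x. f x + g x)"
  by (simp add: smooth_on_def Ck_on_add)

lemma smooth_on_mult:
  fixes f g :: "'a::euclidean_space \<Rightarrow> real"
  shows "open S \<Longrightarrow> smooth_on S f \<Longrightarrow> smooth_on S g \<Longrightarrow> smooth_on S (\<lambda>x. f x * g x)"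
  by (simp add: smooth_on_def Ck_on_mult)

lemma smooth_on_inverse:
  fixes f :: "'a::euclidean_space \<Rightarrow> real"
  shows "open S \<Longrightarrow> (\<And>x. x \<in> S \<Longrightarrow> f x \<noteq> 0) \<Longrightarrow> smooth_on S f \<Longrightarrow> smooth_on S (\<lambda>x. inverse (f x))"
  by (simp add: smooth_on_def Ck_on_inverse)

lemma smooth_on_sum:
  "open S \<Longrightarrow> (\<And>i. i \<in> I \<Longrightarrow> smooth_on S (f i)) \<Longrightarrow> smooth_on S (\<lambda>x. \<Sum>i\<in>I. f i x)"
  by (induction I rule: infinite_finite_induct) (auto intro: smooth_on_const smooth_on_add)

section \<open>Charts\<close>

lemma chart_inv_image:
  assumes "smooth_atlas A" "c \<in> A" "y \<in> snd c ` (fst c \<inter> U)"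
  shows "chart_inv c y \<in> fst c" "chart_inv c y \<in> U" "snd c (chart_inv c y) = y"
proof -
  have "homeomorphism (fst c) (snd c ` fst c) (snd c) (chart_inv c)"
    using assms by (auto simp: smooth_atlas_def)
  then have "chart_inv c (snd c x) = x" if "x \<in> fst c" for x
    using that by (auto simp: homeomorphism_def)
  then show "chart_inv c y \<in> fst c" "chart_inv c y \<in> U" "snd c (chart_inv c y) = y"
    using assms(3) by auto
qed

lemma open_chart_image:
  assumes "smooth_atlas A" "c \<in> A" "open U"
  shows "open (snd c ` (fst c \<inter> U))"
proof -
  have "homeomorphism (fst c) (snd c ` fst c) (snd c) (chart_inv c)" "open (snd c ` fst c)"
    using assms by (auto simp: smooth_atlas_def)
  moreover have "openin (top_of_set (fst c)) (fst c \<inter> U)"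
    using assms(3) by (simp add: openin_open_Int)
  ultimately show ?thesis
    using homeomorphism_imp_open_map openin_open_trans by blast
qed

text \<open>The chain rule, applied to the changes of charts in both directions, whose composition is the
identity near \<open>x\<close>.\<close>

lemma chart_vector_invertible:
  fixes A :: "('m::topological_space, 'e::euclidean_space) chart set"
  assumes A: "smooth_atlas A" and c: "c \<in> A" "x \<in> fst c"
  obtains L where "linear (chart_vector A c x)" "linear L"
    "\<And>v. L (chart_vector A c x v) = v" "\<And>v. chart_vector A c x (L v) = v"
proof -
  define d where "d = chosen_chart A x"
  have "x \<in> (\<Union>c\<in>A. fst c)" using A by (simp add: smooth_atlas_def)
  then obtain c' where "c' \<in> A" "x \<in> fst c'" by blast
  then have "d \<in> A \<and> x \<in> fst d"
    unfolding d_def chosen_chart_def by (intro someI[of "\<lambda>c. c \<in> A \<and> x \<in> fst c" c']) auto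
  then have d: "d \<in> A" "x \<in> fst d" by auto
  have inv: "chart_inv a (snd a z) = z" if "a \<in> A" "z \<in> fst a" for a z
    using A that by (auto simp: smooth_atlas_def homeomorphism_def)
  have trans: "(snd b \<circ> chart_inv a) differentiable (at (snd a x))"
    if "a \<in> A" "b \<in> A" "x \<in> fst a" "x \<in> fst b" for a b
  proof -
    have "Ck_on (Suc 0) (snd a ` (fst a \<inter> fst b)) (snd b \<circ> chart_inv a)"
      using A that unfolding smooth_atlas_def smooth_on_def by blast
    then show ?thesis
      by (rule Ck_on_differentiable) (use that in auto)
  qed
  let ?\<phi> = "snd d \<circ> chart_inv c" and ?\<psi> = "snd c \<circ> chart_inv d"
  let ?\<phi>' = "frechet_derivative ?\<phi> (at (snd c x))" and ?\<psi>' = "frechet_derivative ?\<psi> (at (snd d x))"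
  have \<phi>: "(?\<phi> has_derivative ?\<phi>') (at (snd c x))"
    using trans[OF c(1) d(1) c(2) d(2)] by (simp add: frechet_derivative_works)
  have "?\<phi> (snd c x) = snd d x" using inv[OF c] by simp
  then have \<psi>: "(?\<psi> has_derivative ?\<psi>') (at (?\<phi> (snd c x)))"
    using trans[OF d(1) c(1) d(2) c(2)] by (simp add: frechet_derivative_works)
  have "((?\<psi> \<circ> ?\<phi>) has_derivative (?\<psi>' \<circ> ?\<phi>')) (at (snd c x))"
    by (rule diff_chain_at[OF \<phi> \<psi>])
  moreover have "((?\<psi> \<circ> ?\<phi>) has_derivative id) (at (snd c x))"
  proof (rule has_derivative_transform_within_open[where f = id])
    show "open (snd c ` (fst c \<inter> fst d))"
      using open_chart_image[OF A c(1)] A d by (auto simp: smooth_atlas_def)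
    show "snd c x \<in> snd c ` (fst c \<inter> fst d)" using c d by auto
    show "id y = (?\<psi> \<circ> ?\<phi>) y" if "y \<in> snd c ` (fst c \<inter> fst d)" for y
      using that inv[OF c(1)] inv[OF d(1)] by auto
  qed (rule has_derivative_id)
  ultimately have "?\<psi>' \<circ> ?\<phi>' = id"
    by (rule has_derivative_unique)
  then have left: "?\<psi>' (?\<phi>' v) = v" for v by (simp add: fun_eq_iff)
  have lin: "linear ?\<phi>'" "linear ?\<psi>'"
    using \<phi> \<psi> has_derivative_linear by blast+
  have "inj ?\<phi>'" using left by (metis injI)
  then have "surj ?\<phi>'" using lin(1) linear_injective_imp_surjective by blast
  then have "?\<phi>' (?\<psi>' v) = v" for v by (metis left surjD)
  moreover have "chart_vector A c x = ?\<phi>'" by (simp add: chart_vector_def d_def)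
  ultimately show ?thesis
    using that[of ?\<psi>'] lin left by simp
qed

section \<open>Smooth sections of the exterior bundle\<close>

lemma sections_alternating: "f \<in> sections A U \<Longrightarrow> x \<in> U \<Longrightarrow> alternating_multilinear (f x)"
  by (simp add: sections_def)

lemma sections_outside: "f \<in> sections A U \<Longrightarrow> x \<notin> U \<Longrightarrow> f x = 0"
  by (simp add: sections_def)

lemma sections_smooth:
  "f \<in> sections A U \<Longrightarrow> c \<in> A \<Longrightarrow> smooth_on (snd c ` (fst c \<inter> U))
     (\<lambda>y. f (chart_inv c y) (map (chart_vector A c (chart_inv c y)) bs))"
  by (simp add: sections_def Let_def)

lemma sectionsI:
  assumes "\<And>x. x \<in> U \<Longrightarrow> alternating_multilinear (f x)" "\<And>x. x \<notin> U \<Longrightarrow> f x = 0"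
    and "\<And>c bs. c \<in> A \<Longrightarrow> smooth_on (snd c ` (fst c \<inter> U))
     (\<lambda>y. f (chart_inv c y) (map (chart_vector A c (chart_inv c y)) bs))"
  shows "f \<in> sections A U"
  using assms by (simp add: sections_def Let_def)

lemma subspace_sections:
  assumes A: "smooth_atlas A" and U: "open U"
  shows "subspace (sections A U)"
proof (rule subspaceI)
  show "0 \<in> sections A U"
    by (rule sectionsI) (simp_all add: alternating_zero smooth_on_const)
next
  fix f h assume fh: "f \<in> sections A U" "h \<in> sections A U"
  show "f + h \<in> sections A U"
  proof (rule sectionsI)
    fix c bs assume c: "c \<in> A"
    show "smooth_on (snd c ` (fst c \<inter> U))
        (\<lambda>y. (f + h) (chart_inv c y) (map (chart_vector A c (chart_inv c y)) bs))"
      using smooth_on_add[OF open_chart_image[OF A c U] sections_smooth[OF fh(1) c, of bs]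
          sections_smooth[OF fh(2) c, of bs]] by simp
  qed (use fh in \<open>simp_all add: sections_alternating alternating_add sections_outside fun_eq_iff\<close>)
next
  fix a f assume f: "f \<in> sections A U"
  show "a *\<^sub>R f \<in> sections A U"
  proof (rule sectionsI)
    fix c bs assume c: "c \<in> A"
    show "smooth_on (snd c ` (fst c \<inter> U))
        (\<lambda>y. (a *\<^sub>R f) (chart_inv c y) (map (chart_vector A c (chart_inv c y)) bs))"
      using smooth_on_mult[OF open_chart_image[OF A c U] smooth_on_const[of _ a]
          sections_smooth[OF f c, of bs]] by simp
  qed (use f in \<open>simp_all add: sections_alternating alternating_scaleR sections_outside fun_eq_iff\<close>)
qed

lemma degree_part_sections:
  assumes f: "f \<in> sections A U"
  shows "degree_part r f \<in> sections A U"
proof (rule sectionsI)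
  show "alternating_multilinear (degree_part r f x)" if "x \<in> U" for x
    using f that by (simp add: alternating_degree_part sections_alternating)
  show "degree_part r f x = 0" if "x \<notin> U" for x
    using sections_outside[OF f that] by (simp add: degree_part_def fun_eq_iff)
  fix c bs assume c: "c \<in> A"
  show "smooth_on (snd c ` (fst c \<inter> U))
      (\<lambda>y. degree_part r f (chart_inv c y) (map (chart_vector A c (chart_inv c y)) bs))"
    using sections_smooth[OF f c, of bs]
    by (cases "length bs = r") (simp_all add: degree_part_def smooth_on_const)
qed

lemma one_form_sections:
  assumes A: "smooth_atlas A" and U: "open U"
  shows "one_form U \<in> sections A U"
proof (rule sectionsI)
  show "alternating_multilinear (one_form U x)" for x
    by (auto simp: alternating_multilinear_def one_form_def linear_zero)
  show "one_form U x = 0" if "x \<notin> U" for x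
    using that by (simp add: one_form_def fun_eq_iff)
  fix c bs assume c: "c \<in> A"
  show "smooth_on (snd c ` (fst c \<inter> U))
      (\<lambda>y. one_form U (chart_inv c y) (map (chart_vector A c (chart_inv c y)) bs))"
    by (rule smooth_on_cong[OF open_chart_image[OF A c U] _ smooth_on_const[of _ "if bs = [] then 1 else 0"]])
       (use chart_inv_image[OF A c] in \<open>auto simp: one_form_def\<close>)
qed

lemma wedge_sections:
  assumes A: "smooth_atlas A" and U: "open U"
    and f: "f \<in> sections A U" and h: "h \<in> sections A U"
  shows "wedge f h \<in> sections A U"
proof (rule sectionsI)
  show "alternating_multilinear (wedge f h x)" if "x \<in> U" for x
    using f h that by (simp add: wedge_apply alternating_wedge_at sections_alternating)
  show "wedge f h x = 0" if "x \<notin> U" for x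
    using sections_outside[OF f that] by (simp add: wedge_apply)
  fix c bs assume c: "c \<in> A"
  show "smooth_on (snd c ` (fst c \<inter> U))
      (\<lambda>y. wedge f h (chart_inv c y) (map (chart_vector A c (chart_inv c y)) bs))"
    unfolding wedge_apply wedge_at_def length_map nths_map
    by (intro smooth_on_sum smooth_on_mult smooth_on_const sections_smooth f h c
        open_chart_image[OF A c U])
qed

section \<open>Coframes and their volume form\<close>

locale coframe =
  fixes A :: "('m::topological_space, 'e::euclidean_space) chart set" and U :: "'m set"
    and e :: "nat \<Rightarrow> ('m, 'e) form"
  assumes A: "smooth_atlas A" and U: "open U" and e: "local_coframe A U e"
begin

abbreviation frame :: "'m \<Rightarrow> nat \<Rightarrow> 'e" where "frame x \<equiv> (\<lambda>i. dual_frame e i x)"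

lemma e_sections: "i \<in> {1..DIM('e)} \<Longrightarrow> e i \<in> sections A U"
  and e_degree: "i \<in> {1..DIM('e)} \<Longrightarrow> is_form_of_degree 1 (e i)"
  using e by (auto simp: local_coframe_def)

lemma covector_linear: "x \<in> U \<Longrightarrow> i \<in> {1..DIM('e)} \<Longrightarrow> linear (covector (e i) x)"
  using alternating_linear[of "e i x" "[]" "[]"] sections_alternating[OF e_sections]
  by (simp add: covector_def)

text \<open>The linear functional \<open>w \<mapsto> w \<bullet> v\<close> lies in the span of the coframe, and so vanishes at \<open>v\<close>.\<close>

lemma covectors_separate:
  assumes x: "x \<in> U" and zero: "\<And>i. i \<in> {1..DIM('e)} \<Longrightarrow> covector (e i) x v = 0"
  shows "v = 0"
proof -
  have span: "span ((\<lambda>i. covector (e i) x) ` {1..DIM('e)}) = {\<alpha>. linear \<alpha>}"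
    using e x by (simp add: local_coframe_def)
  have "(\<lambda>w. w \<bullet> v) \<in> span ((\<lambda>i. covector (e i) x) ` {1..DIM('e)})"
    unfolding span by (simp add: linear_iff inner_add_left)
  then have "v \<bullet> v = 0"
    by (induction rule: span_induct_alt) (auto simp: zero)
  then show ?thesis by simp
qed

lemma covectors_eqI:
  assumes x: "x \<in> U"
    and eq: "\<And>i. i \<in> {1..DIM('e)} \<Longrightarrow> covector (e i) x v = covector (e i) x w"
  shows "v = w"
proof -
  have "v - w = 0"
    by (rule covectors_separate[OF x]) (simp only: linear_diff[OF covector_linear[OF x]] eq diff_self)
  then show ?thesis by simp
qed

text \<open>The map \<open>L\<close> with the covectors as its components is injective, because they separate vectors, and so
it is surjective.\<close>

lemma dual_basis_exists:
  assumes x: "x \<in> U" and i: "i \<in> {1..DIM('e)}"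
  shows "\<exists>v. \<forall>j\<in>{1..DIM('e)}. covector (e j) x v = (if j = i then 1 else 0)"
proof -
  obtain B :: "nat \<Rightarrow> 'e" where B: "bij_betw B {1..DIM('e)} Basis"
    using finite_same_card_bij[of "{1..DIM('e)}" "Basis :: 'e set"] by auto
  have BB: "B k \<bullet> B j = (if k = j then 1 else 0)" if "k \<in> {1..DIM('e)}" "j \<in> {1..DIM('e)}" for k j
  proof -
    have "B k \<in> Basis" "B j \<in> Basis"
      using bij_betwE[OF B] that by blast+
    moreover have "B k = B j \<longleftrightarrow> k = j"
      using bij_betw_imp_inj_on[OF B] that by (rule inj_on_eq_iff)
    ultimately show ?thesis by (simp add: inner_Basis)
  qed
  define L where "L v = (\<Sum>j\<in>{1..DIM('e)}. covector (e j) x v *\<^sub>R B j)" for v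
  have inner: "L v \<bullet> B j = covector (e j) x v" if "j \<in> {1..DIM('e)}" for v j
  proof -
    have "L v \<bullet> B j = (\<Sum>k\<in>{1..DIM('e)}. if k = j then covector (e j) x v else 0)"
      unfolding L_def inner_sum_left
    proof (rule sum.cong[OF refl])
      fix k assume "k \<in> {1..DIM('e)}"
      then have "B k \<bullet> B j = (if k = j then 1 else 0)"
        using BB that by blast
      then show "(covector (e k) x v *\<^sub>R B k) \<bullet> B j = (if k = j then covector (e j) x v else 0)"
        by simp
    qed
    then show ?thesis using that by simp
  qed
  have "linear L"
    unfolding L_def
    by (intro linear_compose_sum ballI linear_compose[OF covector_linear[OF x], unfolded comp_def])
       (auto simp: linear_iff scaleR_left_distrib)
  moreover have "inj L"
  proof (rule injI)
    fix v w assume "L v = L w"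
    then show "v = w"
      using inner by (intro covectors_eqI[OF x]) metis
  qed
  ultimately have "surj L" using linear_injective_imp_surjective by blast
  then obtain v where v: "L v = B i" by (metis surjD)
  have "covector (e j) x v = (if j = i then 1 else 0)" if "j \<in> {1..DIM('e)}" for j
  proof -
    have "B i \<bullet> B j = (if j = i then 1 else 0)"
      using BB[OF i that] by auto
    then show ?thesis using inner[OF that, of v] v by simp
  qed
  then show ?thesis by blast
qed

lemma covector_dual_frame:
  assumes x: "x \<in> U" and "i \<in> {1..DIM('e)}" "j \<in> {1..DIM('e)}"
  shows "covector (e j) x (frame x i) = (if j = i then 1 else 0)"
proof -
  have "\<exists>!v. \<forall>j\<in>{1..DIM('e)}. covector (e j) x v = (if j = i then 1 else 0)"
  proof (rule ex_ex1I[OF dual_basis_exists[OF assms(1,2)]])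
    fix v w
    assume "\<forall>j\<in>{1..DIM('e)}. covector (e j) x v = (if j = i then 1 else 0)"
      "\<forall>j\<in>{1..DIM('e)}. covector (e j) x w = (if j = i then 1 else 0)"
    then show "v = w" by (intro covectors_eqI[OF x]) simp
  qed
  from theI'[OF this] show ?thesis
    using assms(3) by (simp add: dual_frame_def)
qed

lemma span_dual_frame:
  assumes x: "x \<in> U"
  shows "span (frame x ` {1..DIM('e)}) = UNIV"
proof -
  have "v \<in> span (frame x ` {1..DIM('e)})" for v
  proof -
    let ?w = "\<Sum>i\<in>{1..DIM('e)}. covector (e i) x v *\<^sub>R frame x i"
    have "v - ?w = 0"
    proof (rule covectors_separate[OF x])
      fix j assume j: "j \<in> {1..DIM('e)}"
      have "covector (e j) x ?w = (\<Sum>i\<in>{1..DIM('e)}. covector (e i) x v * (if j = i then 1 else 0))"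
        using covector_linear[OF x j] covector_dual_frame[OF x _ j]
        by (simp add: linear_sum linear_scale)
      also have "\<dots> = covector (e j) x v"
        using j by (simp add: if_distrib cong: if_cong)
      finally show "covector (e j) x (v - ?w) = 0"
        by (simp add: linear_diff[OF covector_linear[OF x j]])
    qed
    moreover have "?w \<in> span (frame x ` {1..DIM('e)})"
      by (intro span_sum span_scale span_base) auto
    ultimately show ?thesis by simp
  qed
  then show ?thesis by auto
qed

lemma sections_eqI:
  assumes f: "f \<in> sections A U" and h: "h \<in> sections A U"
    and coef: "\<And>x K. x \<in> U \<Longrightarrow> K \<subseteq> {1..DIM('e)} \<Longrightarrow> coefficient (frame x) (f x) K = coefficient (frame x) (h x) K"
  shows "f = h"
proof
  fix x
  show "f x = h x"
  proof (cases "x \<in> U")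
    case True
    have "f x + (- 1) *\<^sub>R h x = 0"
    proof (rule alternating_determined_by_coefficients[OF _ _ span_dual_frame[OF True]])
      show "alternating_multilinear (f x + (- 1) *\<^sub>R h x)"
        by (intro alternating_add alternating_scaleR sections_alternating[OF f True]
            sections_alternating[OF h True])
      show "coefficient (frame x) (f x + (- 1) *\<^sub>R h x) K = 0" if "K \<subseteq> {1..DIM('e)}" for K
        using coef[OF True that] by (simp add: coefficient_def)
    qed simp
    then show ?thesis by (simp add: fun_eq_iff)
  qed (simp add: sections_outside[OF f] sections_outside[OF h])
qed

lemma coefficient_one_form:
  "x \<in> U \<Longrightarrow> finite K \<Longrightarrow> coefficient (frame x) (one_form U x) K = (if K = {} then 1 else 0)"
  by (simp add: coefficient_def one_form_def)

lemma coefficient_e: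
  assumes "x \<in> U" "i \<in> {1..DIM('e)}" "K \<subseteq> {1..DIM('e)}"
  shows "coefficient (frame x) (e i x) K = (if K = {i} then 1 else 0)"
proof (cases "card K = 1")
  case True
  then obtain j where "K = {j}" by (auto simp: card_1_singleton_iff)
  then show ?thesis
    using assms covector_dual_frame[of x j i] by (auto simp: coefficient_def covector_def)
next
  case False
  then have "coefficient (frame x) (e i x) K = 0"
    using e_degree[OF assms(2)] by (simp add: coefficient_def is_form_of_degree_def)
  then show ?thesis using False by auto
qed

definition ordered_wedge :: "nat list \<Rightarrow> ('m, 'e) form" where
  "ordered_wedge ks = foldr wedge (map e ks) (one_form U)"

lemma ordered_wedge_simps:
  "ordered_wedge [] = one_form U" "ordered_wedge (k # ks) = wedge (e k) (ordered_wedge ks)"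
  by (simp_all add: ordered_wedge_def)

lemma ordered_wedge_sections: "set ks \<subseteq> {1..DIM('e)} \<Longrightarrow> ordered_wedge ks \<in> sections A U"
  by (induction ks) (simp_all add: ordered_wedge_simps one_form_sections A U wedge_sections e_sections)

text \<open>The least index is split off first, so that no sign arises.\<close>

lemma coefficient_ordered_wedge:
  assumes "x \<in> U" "set ks \<subseteq> {1..DIM('e)}" "sorted_wrt (<) ks" "K \<subseteq> {1..DIM('e)}"
  shows "coefficient (frame x) (ordered_wedge ks x) K = (if K = set ks then 1 else 0)"
  using assms(2-4)
proof (induction ks arbitrary: K)
  case Nil
  then show ?case
    using finite_subset[of K "{1..DIM('e)}"] by (simp add: ordered_wedge_simps coefficient_one_form assms(1))
next
  case (Cons k ks)
  have fin: "finite K" using Cons.prems(3) finite_subset by auto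
  have k: "k \<in> {1..DIM('e)}" "k \<notin> set ks" using Cons.prems by auto
  have "coefficient (frame x) (ordered_wedge (k # ks) x) K =
      (\<Sum>I\<in>Pow K. clifford_sign 0 I (K - I) * coefficient (frame x) (e k x) I *
        coefficient (frame x) (ordered_wedge ks x) (K - I))"
    unfolding ordered_wedge_simps wedge_apply by (rule coefficient_wedge_at[OF fin])
  also have "\<dots> = (\<Sum>I\<in>Pow K. if I = {k} then (if K = set (k # ks) then 1 else 0) else 0)"
  proof (rule sum.cong[OF refl])
    fix I assume I: "I \<in> Pow K"
    have IH: "coefficient (frame x) (ordered_wedge ks x) (K - I) = (if K - I = set ks then 1 else 0)"
      by (rule Cons.IH) (use Cons.prems in auto)
    have s: "clifford_sign 0 {k} (set ks) = 1"
    proof -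
      have none: "{j \<in> set ks. j < k} = {}" using Cons.prems(2) by force
      show ?thesis
        using clifford_sign_singleton_left[of "set ks" k 0, unfolded none] k by simp
    qed
    have "I = {k} \<Longrightarrow> K - I = set ks \<longleftrightarrow> K = set (k # ks)"
      using I k by auto
    then show "clifford_sign 0 I (K - I) * coefficient (frame x) (e k x) I *
        coefficient (frame x) (ordered_wedge ks x) (K - I) =
        (if I = {k} then (if K = set (k # ks) then 1 else 0) else 0)"
      using I Cons.prems(3) s unfolding IH by (subst coefficient_e[OF assms(1) k(1)]) auto
  qed
  also have "\<dots> = (if K = set (k # ks) then 1 else 0)"
    using fin by auto
  finally show ?case .
qed

lemma volume_form_ordered_wedge: "volume_form U e = ordered_wedge [1..<Suc DIM('e)]"
  by (simp add: volume_form_def ordered_wedge_def)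

lemma volume_form_sections: "volume_form U e \<in> sections A U"
  unfolding volume_form_ordered_wedge by (rule ordered_wedge_sections) auto

lemma coefficient_volume_form:
  "x \<in> U \<Longrightarrow> K \<subseteq> {1..DIM('e)} \<Longrightarrow> coefficient (frame x) (volume_form U e x) K = (if K = {1..DIM('e)} then 1 else 0)"
  unfolding volume_form_ordered_wedge
  by (subst coefficient_ordered_wedge) (auto simp: atLeastLessThanSuc_atLeastAtMost simp del: upt_Suc)

text \<open>The only nonzero coefficient of the volume form has degree \<open>n\<close>.\<close>

lemma degree_part_volume_form: "degree_part DIM('e) (volume_form U e) = volume_form U e"
proof (rule sections_eqI[OF degree_part_sections volume_form_sections])
  fix x K assume x: "x \<in> U" and K: "K \<subseteq> {1..DIM('e)}"
  have "finite K" using K finite_subset by auto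
  moreover have "card K = DIM('e)" if "K = {1..DIM('e)}" using that by simp
  ultimately show "coefficient (frame x) (degree_part DIM('e) (volume_form U e) x) K =
      coefficient (frame x) (volume_form U e x) K"
    using coefficient_volume_form[OF x K] by (auto simp: coefficient_degree_part)
qed (rule volume_form_sections)

text \<open>By the Leibniz rule the contraction is built from the \<open>e\<^sup>k\<close> with constant coefficients, so its
smoothness does not depend on that of the dual frame. This starts the proof
that the dual frame is smooth.\<close>

lemma contraction_ordered_wedge_sections:
  assumes i: "i \<in> {1..DIM('e)}" and "set ks \<subseteq> {1..DIM('e)}"
  shows "contraction (dual_frame e i) (ordered_wedge ks) \<in> sections A U"
  using assms(2)
proof (induction ks)
  case Nil
  have "contraction (dual_frame e i) (one_form U) = 0"
    by (rule contraction_degree_0) (simp add: is_form_of_degree_def one_form_def)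
  then show ?case
    using subspace_0[OF subspace_sections[OF A U]] by (simp only: ordered_wedge_simps)
next
  case (Cons k ks)
  have k: "k \<in> {1..DIM('e)}" using Cons.prems by simp
  have "contraction (dual_frame e i) (e k) = (\<lambda>x. e k x [dual_frame e i x] *\<^sub>R one_form U x)"
    by (rule contraction_degree_1[OF e_degree[OF k] sections_outside[OF e_sections[OF k]]])
  also have "\<dots> = (if k = i then 1 else 0) *\<^sub>R one_form U"
    using covector_dual_frame[OF _ i k] by (auto simp: fun_eq_iff one_form_def covector_def)
  finally have "contraction (dual_frame e i) (ordered_wedge (k # ks)) =
      wedge ((if k = i then 1 else 0) *\<^sub>R one_form U) (ordered_wedge ks) +
      (- 1) ^ 1 *\<^sub>R wedge (e k) (contraction (dual_frame e i) (ordered_wedge ks))"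
    unfolding ordered_wedge_simps by (simp only: contraction_wedge[OF e_degree[OF k]])
  also have "\<dots> \<in> sections A U"
    using Cons k
    by (intro subspace_add subspace_scale subspace_sections[OF A U] wedge_sections[OF A U]
        one_form_sections[OF A U] ordered_wedge_sections e_sections) auto
  finally show ?case .
qed

lemma volume_form_eq_0:
  assumes "length vs \<noteq> DIM('e)"
  shows "volume_form U e x vs = 0"
  using assms by (subst degree_part_volume_form[symmetric]) (simp add: degree_part_def)

text \<open>If the top form vanished on one spanning family of \<open>n\<close> vectors, all of its coefficients with respect to
that family would vanish, and with them the form itself.\<close>

lemma volume_form_nonzero:
  assumes x: "x \<in> U" and cs: "length cs = DIM('e)" "span (set cs) = UNIV"
  shows "volume_form U e x cs \<noteq> 0"
proof
  assume zero: "volume_form U e x cs = 0"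
  have "volume_form U e x = 0"
  proof (rule alternating_determined_by_coefficients[where b = "(!) cs" and N = "{..<DIM('e)}"])
    show "alternating_multilinear (volume_form U e x)"
      by (rule sections_alternating[OF volume_form_sections x])
    show "span ((!) cs ` {..<DIM('e)}) = UNIV"
    proof -
      have "(!) cs ` {..<length cs} = set cs"
        by (metis atLeast_upt list.set_map map_nth)
      then show ?thesis using cs by simp
    qed
    fix K assume K: "K \<subseteq> {..<DIM('e)}"
    show "coefficient ((!) cs) (volume_form U e x) K = 0"
    proof (cases "K = {..<DIM('e)}")
      case True
      then have "map ((!) cs) (sorted_list_of_set K) = cs"
        using cs(1) map_nth[of cs] by (simp add: lessThan_atLeast0)
      then show ?thesis using zero by (simp add: coefficient_def)
    next
      case False
      then have "card K < DIM('e)" using K psubset_card_mono[of "{..<DIM('e)}" K] by auto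
      then show ?thesis
        by (simp add: coefficient_def volume_form_eq_0)
    qed
  qed simp
  then show False
    using coefficient_volume_form[OF x, of "{1..DIM('e)}"] by (simp add: coefficient_def)
qed

text \<open>Cramer's rule: contract \<open>\<theta> \<and> v = 0\<close> with \<open>X\<close>. The form \<open>\<theta> \<and> v\<close> vanishes because its degree exceeds the
dimension.\<close>

lemma cramer_volume_form:
  assumes x: "x \<in> U" and \<theta>: "linear \<theta>"
  shows "\<theta> X * volume_form U e x cs = wedge_at (of_covector \<theta>) (interior_at X (volume_form U e x)) cs"
proof -
  let ?v = "volume_form U e x"
  have "wedge_at (of_covector \<theta>) ?v = 0"
  proof (rule alternating_determined_by_coefficients[OF _ _ span_dual_frame[OF x]])
    show "alternating_multilinear (wedge_at (of_covector \<theta>) ?v)"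
      by (intro alternating_wedge_at alternating_of_covector \<theta> sections_alternating[OF volume_form_sections x])
    fix K assume K: "K \<subseteq> {1..DIM('e)}"
    then have fin: "finite K" by (rule finite_subset) simp
    have "coefficient (frame x) (wedge_at (of_covector \<theta>) ?v) K =
        (\<Sum>I\<in>Pow K. clifford_sign 0 I (K - I) * coefficient (frame x) (of_covector \<theta>) I * coefficient (frame x) ?v (K - I))"
      by (rule coefficient_wedge_at[OF fin])
    also have "\<dots> = 0"
    proof (rule sum.neutral, rule ballI)
      fix I assume I: "I \<in> Pow K"
      show "clifford_sign 0 I (K - I) * coefficient (frame x) (of_covector \<theta>) I * coefficient (frame x) ?v (K - I) = 0"
      proof (cases "I = {}")
        case True
        then show ?thesis by (simp add: coefficient_def of_covector_def)
      next
        case False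
        then have "K - I \<noteq> {1..DIM('e)}" using I K by auto
        moreover have "K - I \<subseteq> {1..DIM('e)}" using K by auto
        ultimately show ?thesis by (simp only: coefficient_volume_form[OF x]) simp
      qed
    qed
    finally show "coefficient (frame x) (wedge_at (of_covector \<theta>) ?v) K = 0" .
  qed simp
  then have "0 = wedge_at (of_covector \<theta>) ?v (X # cs)" by simp
  also have "\<dots> = wedge_at (interior_at X (of_covector \<theta>)) ?v cs +
      wedge_at (grade_involution (of_covector \<theta>)) (interior_at X ?v) cs"
    by (rule wedge_at_Cons)
  also have "interior_at X (of_covector \<theta>) = (\<lambda>vs. if vs = [] then \<theta> X else 0)"
    by (auto simp: interior_at_def of_covector_def fun_eq_iff split: list.splits)
  also have "grade_involution (of_covector \<theta>) = (\<lambda>vs. - of_covector \<theta> vs)"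
    by (auto simp: grade_involution_def of_covector_def fun_eq_iff split: list.splits)
  also have "wedge_at (\<lambda>vs. - of_covector \<theta> vs) (interior_at X ?v) cs =
      - wedge_at (of_covector \<theta>) (interior_at X ?v) cs"
    by (simp add: wedge_at_def sum_negf)
  finally show ?thesis by (simp add: wedge_at_scalar)
qed

text \<open>On the vectors of a chart, contracting with the dual vector \<open>X\<close> gives the sum of values of
\<open>f\<close> weighted by the coordinates of \<open>X\<close> in the chart. Cramer's rule, on the list of the coordinate vectors,
writes these coordinates as quotients of functions that are smooth because \<open>v\<close> and its contraction
with \<open>X\<close> are sections.\<close>

lemma contraction_dual_frame_sections:
  assumes i: "i \<in> {1..DIM('e)}" and f: "f \<in> sections A U"
  shows "contraction (dual_frame e i) f \<in> sections A U"
proof (rule sectionsI)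
  show "alternating_multilinear (contraction (dual_frame e i) f x)" if "x \<in> U" for x
    unfolding contraction_apply by (intro alternating_interior_at sections_alternating[OF f that])
  show "contraction (dual_frame e i) f x = 0" if "x \<notin> U" for x
    using sections_outside[OF f that] by (simp add: contraction_def fun_eq_iff)
  fix c bs assume c: "c \<in> A"
  let ?S = "snd c ` (fst c \<inter> U)" and ?x = "chart_inv c"
  let ?cv = "\<lambda>y. chart_vector A c (chart_inv c y)"
  note S = open_chart_image[OF A c U]
  define W where "W = contraction (dual_frame e i) (volume_form U e)"
  have W: "W \<in> sections A U"
    unfolding W_def volume_form_ordered_wedge by (rule contraction_ordered_wedge_sections[OF i]) auto
  obtain bl :: "'e list" where bl: "set bl = Basis" "distinct bl"
    using finite_distinct_list[OF finite_Basis] by blast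
  then have len: "length bl = DIM('e)" by (metis distinct_card)
  define D where "D y = volume_form U e (?x y) (map (?cv y) bl)" for y
  \<comment> \<open>The numerator of the coordinate in direction \<open>k\<close>. The covector \<open>\<theta>\<close> is dual to the chart, so its
    values on the chart vectors are constant, and only \<open>W\<close> varies with \<open>y\<close>.\<close>
  define num where "num k y = (\<Sum>T\<in>Pow {..<length bl}. (- 1) ^ inversions T *
      of_covector (\<lambda>w. w \<bullet> k) (nths bl T) * W (?x y) (map (?cv y) (nths bl (- T))))" for k y
  have expand: "D y \<noteq> 0 \<and> f (?x y) (dual_frame e i (?x y) # map (?cv y) bs) =
      (\<Sum>k\<in>Basis. num k y * inverse (D y) * f (?x y) (map (?cv y) (k # bs)))" if y: "y \<in> ?S" for y
  proof -
    note yx = chart_inv_image[OF A c y]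
    obtain L where cv: "linear (?cv y)" and L: "linear L"
      and left: "\<And>v. L (?cv y v) = v" and right: "\<And>v. ?cv y (L v) = v"
      by (rule chart_vector_invertible[OF A c yx(1)]) (rule that)
    have repr: "v = (\<Sum>k\<in>Basis. (L v \<bullet> k) *\<^sub>R ?cv y k)" for v
    proof -
      have "v = ?cv y (\<Sum>k\<in>Basis. (L v \<bullet> k) *\<^sub>R k)" by (simp add: euclidean_representation right)
      also have "\<dots> = (\<Sum>k\<in>Basis. (L v \<bullet> k) *\<^sub>R ?cv y k)"
        by (simp only: linear_sum[OF cv] linear_scale[OF cv])
      finally show ?thesis .
    qed
    have "v \<in> span (set (map (?cv y) bl))" for v
      by (subst repr) (intro span_sum span_scale span_base, simp add: bl)
    then have D: "D y \<noteq> 0"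
      unfolding D_def by (intro volume_form_nonzero[OF yx(2)]) (auto simp: len)
    let ?X = "dual_frame e i (?x y)"
    have coord: "L ?X \<bullet> k = num k y * inverse (D y)" for k
    proof -
      have "linear (\<lambda>w. L w \<bullet> k)"
        using L by (simp add: linear_iff inner_add_left)
      from cramer_volume_form[OF yx(2) this, of ?X "map (?cv y) bl"]
      have "(L ?X \<bullet> k) * D y = wedge_at (of_covector (\<lambda>w. L w \<bullet> k)) (W (?x y)) (map (?cv y) bl)"
        by (simp add: D_def W_def contraction_apply)
      also have "\<dots> = num k y"
      proof -
        have "of_covector (\<lambda>w. L w \<bullet> k) (map (?cv y) ws) = of_covector (\<lambda>w. w \<bullet> k) ws" for ws
          by (auto simp: of_covector_def left split: list.splits)
        then show ?thesis by (simp add: wedge_at_def num_def nths_map)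
      qed
      finally show ?thesis using D by (simp add: field_simps)
    qed
    have lin: "linear (\<lambda>v. f (?x y) (v # map (?cv y) bs))"
      using alternating_linear[OF sections_alternating[OF f yx(2)], of "[]"] by simp
    have "f (?x y) (?X # map (?cv y) bs) =
        f (?x y) ((\<Sum>k\<in>Basis. (L ?X \<bullet> k) *\<^sub>R ?cv y k) # map (?cv y) bs)"
      using repr[of ?X] by simp
    also have "\<dots> = (\<Sum>k\<in>Basis. (L ?X \<bullet> k) * f (?x y) (?cv y k # map (?cv y) bs))"
      using linear_sum[OF lin, of "\<lambda>k. (L ?X \<bullet> k) *\<^sub>R ?cv y k" Basis] linear_scale[OF lin] by simp
    finally show ?thesis using D by (simp add: coord)
  qed
  have "smooth_on ?S (\<lambda>y. \<Sum>k\<in>Basis. num k y * inverse (D y) * f (?x y) (map (?cv y) (k # bs)))"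
  proof (intro smooth_on_sum smooth_on_mult smooth_on_inverse S)
    show "smooth_on ?S (num k)" for k
      unfolding num_def
      by (intro smooth_on_sum smooth_on_mult smooth_on_const sections_smooth W c S)
    show "smooth_on ?S D"
      unfolding D_def by (intro sections_smooth volume_form_sections c)
    show "D y \<noteq> 0" if "y \<in> ?S" for y using expand[OF that] by simp
    show "smooth_on ?S (\<lambda>y. f (?x y) (map (?cv y) (k # bs)))" for k
      by (intro sections_smooth f c)
  qed
  then show "smooth_on ?S (\<lambda>y. contraction (dual_frame e i) f (?x y) (map (?cv y) bs))"
    by (rule smooth_on_cong[OF S, rotated]) (simp add: contraction_def expand)
qed

end

section \<open>The algebra of sections\<close>

locale metric_coframe = coframe A U e
  for A :: "('m::topological_space, 'e::euclidean_space) chart set" and U :: "'m set"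
    and e :: "nat \<Rightarrow> ('m, 'e) form" +
  fixes g :: "('m, 'e) metric" and p :: nat
  assumes metric: "x \<in> U \<Longrightarrow> i \<in> {1..DIM('e)} \<Longrightarrow> j \<in> {1..DIM('e)} \<Longrightarrow>
    inverse_metric g e i j x = (if i \<noteq> j then 0 else metric_sign p i)"
begin

text \<open>The functions \<open>g\<^sup>i\<^sup>j\<close> are constant on \<open>U\<close>, and their values elsewhere are multiplied by \<open>0\<close>.\<close>

lemma contracted_wedge_sections:
  "f \<in> sections A U \<Longrightarrow> h \<in> sections A U \<Longrightarrow> contracted_wedge g e l f h \<in> sections A U"
proof (induction l arbitrary: f h)
  case 0
  then show ?case by (simp add: wedge_sections A U)
next
  case (Suc l)
  let ?F = "\<lambda>i j. contracted_wedge g e l (contraction (dual_frame e i) f) (contraction (dual_frame e j) h)"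
  have "(\<lambda>x. inverse_metric g e i j x *\<^sub>R ?F i j x) \<in> sections A U"
    if ij: "i \<in> {1..DIM('e)}" "j \<in> {1..DIM('e)}" for i j
  proof -
    have F: "?F i j \<in> sections A U"
      by (intro Suc.IH contraction_dual_frame_sections ij Suc.prems)
    have "(\<lambda>x. inverse_metric g e i j x *\<^sub>R ?F i j x) = (if i \<noteq> j then 0 else metric_sign p i) *\<^sub>R ?F i j"
    proof
      fix x
      show "inverse_metric g e i j x *\<^sub>R ?F i j x = ((if i \<noteq> j then 0 else metric_sign p i) *\<^sub>R ?F i j) x"
        using metric[OF _ ij, of x] sections_outside[OF F, of x] by (cases "x \<in> U") auto
    qed
    then show ?thesis using subspace_scale[OF subspace_sections[OF A U] F] by simp
  qed
  then show ?case
    by (simp only: contracted_wedge.simps) (intro subspace_sum subspace_sections[OF A U])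
qed

lemma graf_sections:
  assumes "f \<in> sections A U" "h \<in> sections A U"
  shows "graf g e f h \<in> sections A U"
proof -
  have "graf_homogeneous g e r s (degree_part r f) (degree_part s h) \<in> sections A U" for r s
    unfolding graf_homogeneous_def
    by (auto intro!: subspace_scale subspace_sum subspace_sections[OF A U] contracted_wedge_sections
        degree_part_sections assms)
  then show ?thesis
    unfolding graf_def by (intro subspace_sum subspace_sections[OF A U])
qed

lemma coefficient_graf_sections:
  assumes f: "f \<in> sections A U" and h: "h \<in> sections A U" and x: "x \<in> U" and K: "K \<subseteq> {1..DIM('e)}"
  shows "coefficient (frame x) (graf g e f h x) K =
    clifford_mult p {1..DIM('e)} (coefficient (frame x) (f x)) (coefficient (frame x) (h x)) K"
  using coefficient_graf[of g e x p f h K] metric[OF x] sections_alternating[OF f x]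
    sections_alternating[OF h x] K by blast

lemma graf_add_left:
  assumes "f \<in> sections A U" "f' \<in> sections A U" "h \<in> sections A U"
  shows "graf g e (f + f') h = graf g e f h + graf g e f' h"
proof (rule sections_eqI)
  have ff: "f + f' \<in> sections A U" by (intro subspace_add subspace_sections[OF A U] assms)
  show "graf g e (f + f') h \<in> sections A U" "graf g e f h + graf g e f' h \<in> sections A U"
    using assms ff by (auto intro!: graf_sections subspace_add subspace_sections[OF A U])
  fix x K assume "x \<in> U" "K \<subseteq> {1..DIM('e)}"
  note c = coefficient_graf_sections[OF _ _ this]
  have "coefficient (frame x) ((graf g e f h + graf g e f' h) x) K =
      coefficient (frame x) (graf g e f h x) K + coefficient (frame x) (graf g e f' h x) K"
    by (simp add: coefficient_def)
  then show "coefficient (frame x) (graf g e (f + f') h x) K = coefficient (frame x) ((graf g e f h + graf g e f' h) x) K"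
    by (simp only: c[OF ff assms(3)] c[OF assms(1,3)] c[OF assms(2,3)])
       (simp add: clifford_mult_def coefficient_def algebra_simps sum.distrib)
qed

lemma graf_add_right:
  assumes "f \<in> sections A U" "h \<in> sections A U" "h' \<in> sections A U"
  shows "graf g e f (h + h') = graf g e f h + graf g e f h'"
proof (rule sections_eqI)
  have hh: "h + h' \<in> sections A U" by (intro subspace_add subspace_sections[OF A U] assms)
  show "graf g e f (h + h') \<in> sections A U" "graf g e f h + graf g e f h' \<in> sections A U"
    using assms hh by (auto intro!: graf_sections subspace_add subspace_sections[OF A U])
  fix x K assume "x \<in> U" "K \<subseteq> {1..DIM('e)}"
  note c = coefficient_graf_sections[OF _ _ this]
  have "coefficient (frame x) ((graf g e f h + graf g e f h') x) K =
      coefficient (frame x) (graf g e f h x) K + coefficient (frame x) (graf g e f h' x) K"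
    by (simp add: coefficient_def)
  then show "coefficient (frame x) (graf g e f (h + h') x) K = coefficient (frame x) ((graf g e f h + graf g e f h') x) K"
    by (simp only: c[OF assms(1) hh] c[OF assms(1,2)] c[OF assms(1,3)])
       (simp add: clifford_mult_def coefficient_def algebra_simps sum.distrib)
qed

lemma graf_scaleR:
  assumes "f \<in> sections A U" "h \<in> sections A U"
  shows "graf g e (a *\<^sub>R f) h = a *\<^sub>R graf g e f h" "graf g e f (a *\<^sub>R h) = a *\<^sub>R graf g e f h"
proof -
  have scale: "a *\<^sub>R k \<in> sections A U" if "k \<in> sections A U" for k
    by (intro subspace_scale subspace_sections[OF A U] that)
  have c': "coefficient (frame x) ((a *\<^sub>R k) x) K = a * coefficient (frame x) (k x) K" for k x K
    by (simp add: coefficient_def)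
  show "graf g e (a *\<^sub>R f) h = a *\<^sub>R graf g e f h"
  proof (rule sections_eqI)
    fix x K assume "x \<in> U" "K \<subseteq> {1..DIM('e)}"
    note c = coefficient_graf_sections[OF _ _ this]
    show "coefficient (frame x) (graf g e (a *\<^sub>R f) h x) K = coefficient (frame x) ((a *\<^sub>R graf g e f h) x) K"
      unfolding c' c[OF assms] c[OF scale[OF assms(1)] assms(2)] clifford_mult_def sum_distrib_left
      by (simp only: c' mult_ac)
  qed (auto intro!: graf_sections scale assms)
  show "graf g e f (a *\<^sub>R h) = a *\<^sub>R graf g e f h"
  proof (rule sections_eqI)
    fix x K assume "x \<in> U" "K \<subseteq> {1..DIM('e)}"
    note c = coefficient_graf_sections[OF _ _ this]
    show "coefficient (frame x) (graf g e f (a *\<^sub>R h) x) K = coefficient (frame x) ((a *\<^sub>R graf g e f h) x) K"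
      unfolding c' c[OF assms] c[OF assms(1) scale[OF assms(2)]] clifford_mult_def sum_distrib_left
      by (simp only: c' mult_ac)
  qed (auto intro!: graf_sections scale assms)
qed

lemma graf_assoc:
  assumes f: "f \<in> sections A U" and h: "h \<in> sections A U" and k: "k \<in> sections A U"
  shows "graf g e (graf g e f h) k = graf g e f (graf g e h k)"
proof (rule sections_eqI)
  show "graf g e (graf g e f h) k \<in> sections A U" "graf g e f (graf g e h k) \<in> sections A U"
    by (intro graf_sections f h k)+
  fix x K assume x: "x \<in> U" and K: "K \<subseteq> {1..DIM('e)}"
  let ?m = "clifford_mult p {1..DIM('e)}" and ?c = "\<lambda>f. coefficient (frame x) (f x)"
  have "?c (graf g e (graf g e f h) k) K = ?m (?c (graf g e f h)) (?c k) K"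
    by (intro coefficient_graf_sections graf_sections f h k x K)
  also have "\<dots> = ?m (?m (?c f) (?c h)) (?c k) K"
    by (rule clifford_mult_cong[OF coefficient_graf_sections[OF f h x] refl K])
  also have "\<dots> = ?m (?c f) (?m (?c h) (?c k)) K"
    by (rule clifford_mult_assoc[OF _ K]) simp
  also have "\<dots> = ?m (?c f) (?c (graf g e h k)) K"
    by (rule clifford_mult_cong[OF refl coefficient_graf_sections[OF h k x, symmetric] K])
  also have "\<dots> = ?c (graf g e f (graf g e h k)) K"
    by (intro coefficient_graf_sections[symmetric] graf_sections f h k x K)
  finally show "?c (graf g e (graf g e f h) k) K = ?c (graf g e f (graf g e h k)) K" .
qed

lemma coefficient_one_form_subset:
  "x \<in> U \<Longrightarrow> K \<subseteq> {1..DIM('e)} \<Longrightarrow> coefficient (frame x) (one_form U x) K = (if K = {} then 1 else 0)"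
  by (rule coefficient_one_form) (auto dest: finite_subset)

lemma graf_one_form_left:
  assumes f: "f \<in> sections A U"
  shows "graf g e (one_form U) f = f"
proof (rule sections_eqI[OF graf_sections[OF one_form_sections[OF A U] f] f])
  fix x K assume x: "x \<in> U" and K: "K \<subseteq> {1..DIM('e)}"
  show "coefficient (frame x) (graf g e (one_form U) f x) K = coefficient (frame x) (f x) K"
    unfolding coefficient_graf_sections[OF one_form_sections[OF A U] f x K]
    by (rule trans[OF clifford_mult_cong[OF coefficient_one_form_subset[OF x] refl K]])
       (assumption, rule clifford_mult_one_left[OF finite_atLeastAtMost K])
qed

lemma graf_one_form_right:
  assumes f: "f \<in> sections A U"
  shows "graf g e f (one_form U) = f"
proof (rule sections_eqI[OF graf_sections[OF f one_form_sections[OF A U]] f])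
  fix x K assume x: "x \<in> U" and K: "K \<subseteq> {1..DIM('e)}"
  show "coefficient (frame x) (graf g e f (one_form U) x) K = coefficient (frame x) (f x) K"
    unfolding coefficient_graf_sections[OF f one_form_sections[OF A U] x K]
    by (rule trans[OF clifford_mult_cong[OF refl coefficient_one_form_subset[OF x] K]])
       (assumption, rule clifford_mult_one_right[OF finite_atLeastAtMost K])
qed

lemma graf_volume_form_central:
  assumes f: "f \<in> sections A U" and odd: "odd DIM('e)"
  shows "graf g e (volume_form U e) f = graf g e f (volume_form U e)"
proof (rule sections_eqI)
  show "graf g e (volume_form U e) f \<in> sections A U" "graf g e f (volume_form U e) \<in> sections A U"
    by (intro graf_sections f volume_form_sections)+
  fix x K assume x: "x \<in> U" and K: "K \<subseteq> {1..DIM('e)}"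
  let ?m = "clifford_mult p {1..DIM('e)}" and ?c = "\<lambda>f. coefficient (frame x) (f x)"
  let ?v = "\<lambda>I. if I = {1..DIM('e)} then 1 else 0"
  have "?c (graf g e (volume_form U e) f) K = ?m ?v (?c f) K"
    unfolding coefficient_graf_sections[OF volume_form_sections f x K]
    by (rule clifford_mult_cong[OF coefficient_volume_form[OF x] refl K])
  also have "\<dots> = ?m (?c f) ?v K"
    by (rule clifford_volume_central[OF _ K]) (use odd in simp_all)
  also have "\<dots> = ?c (graf g e f (volume_form U e)) K"
    unfolding coefficient_graf_sections[OF f volume_form_sections x K]
    by (rule clifford_mult_cong[OF refl coefficient_volume_form[OF x, symmetric] K])
  finally show "?c (graf g e (volume_form U e) f) K = ?c (graf g e f (volume_form U e)) K" .
qed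

lemma graf_volume_form_square:
  assumes sign: "clifford_sign p {1..DIM('e)} {1..DIM('e)} = 1"
  shows "graf g e (volume_form U e) (volume_form U e) = one_form U"
proof (rule sections_eqI)
  show "graf g e (volume_form U e) (volume_form U e) \<in> sections A U" "one_form U \<in> sections A U"
    by (intro graf_sections volume_form_sections one_form_sections A U)+
  fix x K assume x: "x \<in> U" and K: "K \<subseteq> {1..DIM('e)}"
  let ?v = "\<lambda>I. if I = {1..DIM('e)} then 1 else 0"
  have "coefficient (frame x) (graf g e (volume_form U e) (volume_form U e) x) K =
      clifford_mult p {1..DIM('e)} ?v ?v K"
    unfolding coefficient_graf_sections[OF volume_form_sections volume_form_sections x K]
    by (rule clifford_mult_cong[OF coefficient_volume_form[OF x] coefficient_volume_form[OF x] K])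
  also have "\<dots> = (if K = {} then 1 else 0)"
    by (rule clifford_volume_square[OF _ K sign]) simp
  finally show "coefficient (frame x) (graf g e (volume_form U e) (volume_form U e) x) K =
      coefficient (frame x) (one_form U x) K"
    by (simp only: coefficient_one_form_subset[OF x K])
qed

lemma P_map_splitting:
  assumes "odd DIM('e)" "clifford_sign p {1..DIM('e)} {1..DIM('e)} = 1" "\<sigma> * \<sigma> = 1"
  shows "algebra_endomorphism (sections A U) (graf g e) (P_map \<sigma> g U e) \<and>
    subalgebra_of (Gamma_part \<sigma> A g U e) (sections A U) (graf g e) \<and>
    is_unit_of (p_elem \<sigma> U e) (Gamma_part \<sigma> A g U e) (graf g e)"
proof -
  have P: "P_map \<sigma> g U e = (\<lambda>f. graf g e f (p_elem \<sigma> U e))"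
    by (simp add: P_map_def fun_eq_iff)
  show ?thesis
    unfolding Gamma_part_def P
  proof (rule central_involution_splitting[where u = "one_form U" and v = "volume_form U e"])
    show "subspace (sections A U)" by (rule subspace_sections[OF A U])
    show "one_form U \<in> sections A U" by (rule one_form_sections[OF A U])
    show "volume_form U e \<in> sections A U" by (rule volume_form_sections)
    show "graf g e (volume_form U e) f = graf g e f (volume_form U e)" if "f \<in> sections A U" for f
      using that assms(1) by (rule graf_volume_form_central)
    show "graf g e (volume_form U e) (volume_form U e) = one_form U"
      using assms(2) by (rule graf_volume_form_square)
    show "p_elem \<sigma> U e = (1 / 2) *\<^sub>R (one_form U + \<sigma> *\<^sub>R volume_form U e)"
      by (rule p_elem_def)
  qed (fact assms(3) graf_sections graf_add_left graf_add_right graf_scaleR graf_assoc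
      graf_one_form_left graf_one_form_right)+
qed

end

theorem proposition3p14:
  fixes A :: "('m::t2_space, 'e::euclidean_space) chart set"
    and g :: "('m, 'e) metric"
    and p q :: nat
    and U :: "'m set"
    and e :: "nat \<Rightarrow> ('m, 'e) form"
  assumes "pseudo_riemannian_manifold A g p q"
    and "open U"
    and "orthonormal_coframe A g p U e"
    and "odd DIM('e)"
    and "(int p - int q) mod 8 \<in> {0, 1, 4, 5}"
  shows "(algebra_endomorphism (sections A U) (graf g e) (P_map 1 g U e) \<and>
          algebra_endomorphism (sections A U) (graf g e) (P_map (- 1) g U e)) \<and>
         (subalgebra_of (Gamma_part 1 A g U e) (sections A U) (graf g e) \<and>
          subalgebra_of (Gamma_part (- 1) A g U e) (sections A U) (graf g e)) \<and>
         (is_unit_of (p_elem 1 U e) (Gamma_part 1 A g U e) (graf g e) \<and>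
          is_unit_of (p_elem (- 1) U e) (Gamma_part (- 1) A g U e) (graf g e))"
proof -
  interpret metric_coframe A U e g p
  proof
    show "smooth_atlas A" using assms(1) by (simp add: pseudo_riemannian_manifold_def)
    show "open U" by (rule assms(2))
    show "local_coframe A U e" using assms(3) by (simp add: orthonormal_coframe_def)
    show "inverse_metric g e i j x = (if i \<noteq> j then 0 else metric_sign p i)"
      if "x \<in> U" "i \<in> {1..DIM('e)}" "j \<in> {1..DIM('e)}" for x i j
      using assms(3) that unfolding orthonormal_coframe_def metric_sign_def by simp
  qed
  have n: "p + q = DIM('e)"
    using assms(1) by (simp add: pseudo_riemannian_manifold_def has_signature_def)
  have sign: "clifford_sign p {1..DIM('e)} {1..DIM('e)} = 1"
    using clifford_sign_volume_eq_1[of p q] assms(4,5) unfolding n by blast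
  show ?thesis
    using P_map_splitting[OF assms(4) sign, of 1] P_map_splitting[OF assms(4) sign, of "- 1"] by simp
qed

end
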